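(* Let $K$ be a field, $S=K[x_1,\ldots,x_n]$, and let $I\subset S$ be a nonzero proper monomial ideal. Then $$\operatorname{sdepth} I\geq 1+\operatorname{size} I.$$
   Context: Size. Let $I\subset S$ be a proper monomial ideal and let $I=\bigcap_{j=1}^s Q_j$ be a primary decomposition with each $Q_j$ a $P_j$-primary monomial ideal and $\operatorname{Ass}(S/I)=\{P_1,\ldots,P_s\}$. Then $\operatorname{size} I=v+(n-h)-1$, where $h=\operatorname{height}\sum_{j=1}^sQ_j$ and $v$ is the minimum number $t$ such that there exist $j_1<\cdots<j_t$ in $\{1,\dots,s\}$ with $\sqrt{\sum_{k=1}^tQ_{j_k}}=\sqrt{\sum_{j=1}^sQ_j}$. Since $\sqrt{\sum_k Q_{j_k}}=\sum_k P_{j_k}$, the condition is equivalent to $\sum_{k=1}^tP_{j_k}=\sum_{j=1}^sP_j$, so $\operatorname{size} I$ depends only on the set $\operatorname{Ass}(S/I)$. Stanley depth. Let $M$ be a nonzero finitely generated $\mathbb{Z}^n$-graded $S$-module. A Stanley decomposition of $M$ is a finite direct sum decomposition $M=\bigoplus_{i=1}^m u_iK[Z_i]$ of $M$ as a $\mathbb{Z}^n$-graded $K$-vector space, where each $u_i\in M$ is homogeneous, $Z_i\subset\{x_1,\ldots,x_n\}$, and $u_iK[Z_i]$ (the $K$-span of all $u_iw$ with $w$ a monomial in $K[Z_i]$) is a free $K[Z_i]$-module. The Stanley depth $\operatorname{sdepth} M$ is the maximum, over all Stanley decompositions of $M$, of $\min_i|Z_i|$. *)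

theory Defs
  imports "HOL-Library.Poly_Mapping" "HOL-Library.Extended_Nat" "HOL-Library.Cardinality"
begin

text \<open>The polynomial ring over the field \<open>'k\<close> with one variable for every element of the finite type
  \<open>'n\<close>, so that \<open>n = CARD('n)\<close>.  A monomial is an exponent vector in \<open>'n \<Rightarrow>\<^sub>0 nat\<close>, a polynomial maps
  monomials to coefficients, and the whole type is the ring \<open>S\<close>.\<close>

type_synonym 'n monom = "'n \<Rightarrow>\<^sub>0 nat"
type_synonym ('n, 'k) polys = "'n monom \<Rightarrow>\<^sub>0 'k"

definition monomial :: "'n monom \<Rightarrow> ('n, 'k::field) polys"
  where "monomial m = Poly_Mapping.single m 1"

definition const_poly :: "'k::field \<Rightarrow> ('n, 'k) polys"
  where "const_poly c = Poly_Mapping.single 0 c"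

lemma module_times: "module ((*) :: 'a::comm_ring_1 \<Rightarrow> 'a \<Rightarrow> 'a)"
  by unfold_locales (simp_all add: algebra_simps)

abbreviation is_ideal :: "'a::comm_ring_1 set \<Rightarrow> bool"
  where "is_ideal \<equiv> module.subspace (*)"

abbreviation ideal_gen :: "'a::comm_ring_1 set \<Rightarrow> 'a set"
  where "ideal_gen \<equiv> module.span (*)"

definition monomial_ideal :: "('n, 'k::field) polys set \<Rightarrow> bool"
  where "monomial_ideal I \<longleftrightarrow> (\<exists>A. I = ideal_gen (monomial ` A))"

definition prime_ideal :: "'a::comm_ring_1 set \<Rightarrow> bool"
  where "prime_ideal P \<longleftrightarrow>
    is_ideal P \<and> P \<noteq> UNIV \<and> (\<forall>f g. f * g \<in> P \<longrightarrow> f \<in> P \<or> g \<in> P)"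

definition radical :: "'a::comm_ring_1 set \<Rightarrow> 'a set"
  where "radical I = {f. \<exists>k::nat. f ^ k \<in> I}"

definition primary_ideal :: "'a::comm_ring_1 set \<Rightarrow> bool"
  where "primary_ideal Q \<longleftrightarrow>
    is_ideal Q \<and> Q \<noteq> UNIV \<and> (\<forall>f g. f * g \<in> Q \<longrightarrow> f \<in> Q \<or> g \<in> radical Q)"

text \<open>The associated primes of the module \<open>S/I\<close>: the prime ideals that are annihilators of a residue
  class \<open>f + I\<close>.\<close>

definition Ass_quot :: "'a::comm_ring_1 set \<Rightarrow> 'a set set"
  where "Ass_quot I = {P. prime_ideal P \<and> (\<exists>f. P = {g. g * f \<in> I})}"

text \<open>The height of a prime is the supremum of the lengths \<open>k\<close> of chains of primes
  \<open>C 0 \<subset> \<dots> \<subset> C k = P\<close>; the height of an ideal is the least height of a prime containing it.\<close>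

definition height_prime :: "'a::comm_ring_1 set \<Rightarrow> enat"
  where "height_prime P = Sup {enat k | k. \<exists>C :: nat \<Rightarrow> 'a set.
    (\<forall>i\<le>k. prime_ideal (C i)) \<and> (\<forall>i<k. C i \<subset> C (Suc i)) \<and> C k = P}"

definition height :: "'a::comm_ring_1 set \<Rightarrow> enat"
  where "height J = Inf {height_prime P | P. prime_ideal P \<and> J \<subseteq> P}"

text \<open>\<open>Qs\<close> lists \<open>Q\<^sub>1, \<dots>, Q\<^sub>s\<close>; the prime \<open>P\<^sub>j\<close> is the radical of \<open>Q\<^sub>j\<close>.\<close>

definition monomial_primary_decomposition ::
    "('n, 'k::field) polys set \<Rightarrow> ('n, 'k) polys set list \<Rightarrow> bool"
  where "monomial_primary_decomposition I Qs \<longleftrightarrow>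
    I = \<Inter> (set Qs) \<and>
    (\<forall>Q \<in> set Qs. monomial_ideal Q \<and> primary_ideal Q) \<and>
    Ass_quot I = radical ` set Qs"

definition sum_ideals :: "'a::comm_ring_1 set list \<Rightarrow> nat set \<Rightarrow> 'a set"
  where "sum_ideals Qs J = ideal_gen (\<Union>j\<in>J. Qs ! j)"

definition size_v :: "('n, 'k::field) polys set list \<Rightarrow> nat"
  where "size_v Qs = (LEAST t. \<exists>J. J \<noteq> {} \<and> J \<subseteq> {..<length Qs} \<and> card J = t \<and>
    radical (sum_ideals Qs J) = radical (sum_ideals Qs {..<length Qs}))"

text \<open>The value \<open>v + (n - h) - 1\<close>.  Neither subtraction is truncated for the decomposition of a proper
  ideal: the sum of the \<open>Q\<^sub>j\<close> is then a proper ideal of \<open>S\<close>, so \<open>h \<le> n\<close>, and \<open>v \<ge> 1\<close>.\<close>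

definition decomposition_size :: "('n::finite, 'k::field) polys set list \<Rightarrow> enat"
  where "decomposition_size Qs =
    enat (size_v Qs) + (enat CARD('n) - height (sum_ideals Qs {..<length Qs})) - 1"

text \<open>The size does not depend on the chosen decomposition, because it depends only on
  \<open>Ass_quot I\<close>.\<close>

definition ideal_size :: "('n::finite, 'k::field) polys set \<Rightarrow> enat"
  where "ideal_size I = decomposition_size (SOME Qs. monomial_primary_decomposition I Qs)"

text \<open>A graded module is a submodule \<open>M\<close> of an additive group \<open>'m\<close> with scalar multiplication
  \<open>scale\<close> by \<open>S\<close>, whose homogeneous elements of degree \<open>a\<close> are those of \<open>M\<close> in \<open>gr a\<close>.\<close>

definition poly_subring :: "'n set \<Rightarrow> ('n, 'k::field) polys set"
  where "poly_subring Z = {p. \<forall>m \<in> Poly_Mapping.keys p. Poly_Mapping.keys m \<subseteq> Z}"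

definition stanley_space ::
    "(('n, 'k::field) polys \<Rightarrow> 'm \<Rightarrow> 'm::ab_group_add) \<Rightarrow> 'm \<Rightarrow> 'n set \<Rightarrow> 'm set"
  where "stanley_space scale u Z =
    module.span (\<lambda>c. scale (const_poly c)) {scale (monomial w) u | w. Poly_Mapping.keys w \<subseteq> Z}"

text \<open>The cyclic module \<open>uK[Z]\<close> is required to be free with basis \<open>u\<close>; thus \<open>u \<noteq> 0\<close>.
  The last two conjuncts say that \<open>M\<close> is the internal direct sum of the \<open>m\<close> spaces
  \<open>u\<^sub>i K[Z\<^sub>i]\<close>.  These are graded subspaces because every \<open>u\<^sub>i\<close> is homogeneous.\<close>

definition stanley_decomposition ::
    "(('n, 'k::field) polys \<Rightarrow> 'm \<Rightarrow> 'm::ab_group_add) \<Rightarrow> (('n \<Rightarrow> int) \<Rightarrow> 'm set) \<Rightarrow> 'm set \<Rightarrow>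
     nat \<Rightarrow> (nat \<Rightarrow> 'm) \<Rightarrow> (nat \<Rightarrow> 'n set) \<Rightarrow> bool"
  where "stanley_decomposition scale gr M m u Z \<longleftrightarrow>
    (\<forall>i<m. u i \<in> M \<and> (\<exists>a. u i \<in> gr a)) \<and>
    (\<forall>i<m. \<forall>p \<in> poly_subring (Z i). scale p (u i) = 0 \<longrightarrow> p = 0) \<and>
    M = {\<Sum>i<m. y i | y. \<forall>i<m. y i \<in> stanley_space scale (u i) (Z i)} \<and>
    (\<forall>y. (\<forall>i<m. y i \<in> stanley_space scale (u i) (Z i)) \<and> (\<Sum>i<m. y i) = 0 \<longrightarrow>
      (\<forall>i<m. y i = 0))"

definition sdepth ::
    "(('n::finite, 'k::field) polys \<Rightarrow> 'm \<Rightarrow> 'm::ab_group_add) \<Rightarrow> (('n \<Rightarrow> int) \<Rightarrow> 'm set) \<Rightarrow> 'm set \<Rightarrow> nat"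
  where "sdepth scale gr M =
    Max {Min ((\<lambda>i. card (Z i)) ` {..<m}) | m u Z. stanley_decomposition scale gr M m u Z}"

text \<open>The standard grading of \<open>S\<close> by integer vectors: the component of degree \<open>a\<close> is spanned by the
  monomial with exponent vector \<open>a\<close> if \<open>a\<close> is nonnegative, and is zero otherwise.\<close>

definition poly_grading :: "('n \<Rightarrow> int) \<Rightarrow> ('n, 'k::field) polys set"
  where "poly_grading a =
    {p. \<forall>m \<in> Poly_Mapping.keys p. \<forall>i. int (Poly_Mapping.lookup m i) = a i}"

abbreviation sdepth_ideal :: "('n::finite, 'k::field) polys set \<Rightarrow> nat"
  where "sdepth_ideal \<equiv> sdepth (*) poly_grading"

end

theory Submission
  imports Defs "HOL.Topological_Spaces"
begin

text \<open>The theorem is a statement about sets of exponent vectors. A monomial ideal is determined by the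
set \<open>X\<close> of its monomials, and a Stanley decomposition of it amounts to a partition of \<open>X\<close> into finitely
many boxes \<open>u + \<nat>\<^sup>Z\<close>; so a partition of \<open>X\<close> into boxes with \<open>card Z \<ge> d\<close> shows that the Stanley depth is
at least \<open>d\<close>.

By Dickson's lemma the ideal is a finite irredundant intersection of irreducible ideals
\<open>Q\<^sub>c = (x\<^sub>i\<^bsup>c i\<^esup> : c i > 0)\<close>, for exponent vectors \<open>c\<close> in a finite set \<open>C\<close>. The associated primes are the
ideals generated by the variables in \<open>support c\<close>. The size of \<open>I\<close> depends only on these supports, and
adding to a selection \<open>\<sigma> \<subseteq> C\<close> one prime for each variable that it misses and some other support
contains gives
\<open>1 + size I \<le> card \<sigma> + (number of variables outside the supports of \<sigma>)\<close>.
The height that occurs in the size has to be bounded from below only, and this is done by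
the chain of the primes generated by the first \<open>i\<close> variables.

What remains is combinatorial (\<open>box_partition_intersection\<close>): if \<open>d\<close> satisfies all these inequalities,
then the intersection of the \<open>Q\<^sub>c\<close> is partitioned into boxes of dimension at least \<open>d\<close>. This goes by
induction on the set of variables. Choose a variable \<open>x\<close>. Every line in direction \<open>x\<close> meets the
intersection in the empty set or in a ray, whose starting point is the largest \<open>c x\<close> among those
\<open>c\<close> whose ideal does not already contain the part of the monomial without \<open>x\<close>. The lines
whose ray starts at 0 form the analogous intersection with \<open>x\<close> removed. The lines whose start is
governed by a given \<open>k\<close> with \<open>k x > 0\<close> avoid \<open>Q\<^sub>k\<close> off \<open>x\<close>, so their exponents on \<open>support k\<close> take only
finitely many values; once these are fixed, an intersection in the variables outside
\<open>support k\<close> is left. In both cases the inequalities survive with \<open>d - 1\<close> instead of \<open>d\<close>, in the second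
case because \<open>k\<close> can be added to \<open>\<sigma>\<close>. The rays give the missing dimension back.\<close>

section \<open>Partitions into boxes\<close>

definition box :: "'n monom \<Rightarrow> 'n set \<Rightarrow> 'n monom set"
  where "box u Z = {u + w | w. Poly_Mapping.keys w \<subseteq> Z}"

text \<open>Adding the boxes one at a time makes finiteness and disjointness part of the induction
principle, so closure properties need no bookkeeping of indices.\<close>

inductive box_partition :: "nat \<Rightarrow> 'n monom set \<Rightarrow> bool" for d where
  empty: "box_partition d {}"
| insert: "box_partition d (X \<union> box u Z)"
    if "box_partition d X" "d \<le> card Z" "X \<inter> box u Z = {}"

lemma keys_plus_nat:
  fixes a b :: "'n monom"
  shows "Poly_Mapping.keys (a + b) = Poly_Mapping.keys a \<union> Poly_Mapping.keys b"
  by (auto simp: in_keys_iff lookup_add)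

lemma box_partition_box: "d \<le> card Z \<Longrightarrow> box_partition d (box u Z)"
  using box_partition.insert[OF box_partition.empty, of d Z u] by simp

lemma box_partition_mono: "box_partition d' X \<Longrightarrow> d \<le> d' \<Longrightarrow> box_partition d X"
  by (induction rule: box_partition.induct) (auto intro: box_partition.intros)

lemma box_partition_union:
  "box_partition d Y \<Longrightarrow> box_partition d X \<Longrightarrow> X \<inter> Y = {} \<Longrightarrow> box_partition d (X \<union> Y)"
proof (induction rule: box_partition.induct)
  case (insert Y Z u)
  have "box_partition d ((X \<union> Y) \<union> box u Z)"
    using insert by (intro box_partition.insert) auto
  then show ?case by (simp add: Un_assoc)
qed simp

lemma box_partition_UN:
  assumes "finite A" "\<And>a. a \<in> A \<Longrightarrow> box_partition d (X a)"
    "\<And>a b. a \<in> A \<Longrightarrow> b \<in> A \<Longrightarrow> a \<noteq> b \<Longrightarrow> X a \<inter> X b = {}"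
  shows "box_partition d (\<Union>a\<in>A. X a)"
  using assms
proof (induction A rule: finite_induct)
  case (insert a A)
  have "box_partition d ((\<Union>a\<in>A. X a) \<union> X a)"
  proof (rule box_partition_union)
    show "(\<Union>a\<in>A. X a) \<inter> X a = {}"
      using insert.hyps insert.prems(2) by blast
  qed (use insert in auto)
  then show ?case by (simp add: Un_commute)
qed (simp add: box_partition.empty)

lemma image_plus_box: "(+) a ` box u Z = box (a + u) Z"
proof -
  have "(+) a ` box u Z = {a + (u + w) | w. Poly_Mapping.keys w \<subseteq> Z}"
    unfolding box_def by blast
  then show ?thesis by (simp add: box_def add.assoc)
qed

lemma box_partition_translate:
  fixes a :: "'n monom"
  shows "box_partition d X \<Longrightarrow> box_partition d ((+) a ` X)"
proof (induction rule: box_partition.induct)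
  case (insert X Z u)
  have "(+) a ` X \<inter> (+) a ` box u Z = {}"
    using insert by auto
  then show ?case
    using insert by (simp add: image_Un image_plus_box box_partition.insert)
qed (simp add: box_partition.empty)

definition ray :: "'n \<Rightarrow> nat \<Rightarrow> 'n monom set \<Rightarrow> 'n monom set"
  where "ray x k X = {b + Poly_Mapping.single x t | b t. b \<in> X \<and> k \<le> t}"

lemma lookup_ray_part:
  fixes b :: "'n monom"
  assumes "Poly_Mapping.keys b \<subseteq> V" "x \<notin> V"
  shows "Poly_Mapping.lookup (b + Poly_Mapping.single x t) x = t"
  using assms by (auto simp: lookup_add in_keys_iff)

lemma ray_inter_empty:
  assumes "\<forall>b \<in> X \<union> Y. Poly_Mapping.keys b \<subseteq> V" "x \<notin> V" "X \<inter> Y = {}"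
  shows "ray x k X \<inter> ray x l Y = {}"
proof (rule ccontr)
  assume "ray x k X \<inter> ray x l Y \<noteq> {}"
  then obtain b t b' t' where b: "b \<in> X" "b' \<in> Y"
    and eq: "b + Poly_Mapping.single x t = b' + Poly_Mapping.single x t'"
    unfolding ray_def by auto
  have "t = t'"
    using eq lookup_ray_part[OF _ assms(2), of b t] lookup_ray_part[OF _ assms(2), of b' t'] assms(1) b
    by auto
  then have "b = b'" using eq by simp
  then show False using b assms(3) by blast
qed

lemma ray_Un: "ray x k (X \<union> Y) = ray x k X \<union> ray x k Y"
  unfolding ray_def by blast

lemma minus_part:
  fixes w :: "'n monom"
  obtains v where "w = v + Poly_Mapping.single x (Poly_Mapping.lookup w x)"
    "Poly_Mapping.keys v = Poly_Mapping.keys w - {x}"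
proof
  define v where "v = w - Poly_Mapping.single x (Poly_Mapping.lookup w x)"
  show "w = v + Poly_Mapping.single x (Poly_Mapping.lookup w x)"
    by (rule poly_mapping_eqI) (simp add: v_def lookup_add lookup_minus lookup_single when_def)
  show "Poly_Mapping.keys v = Poly_Mapping.keys w - {x}"
    by (auto simp: in_keys_iff v_def lookup_minus lookup_single when_def split: if_splits)
qed

lemma ray_box:
  assumes "x \<notin> Z"
  shows "ray x k (box u Z) = box (u + Poly_Mapping.single x k) (insert x Z)"
proof (intro equalityI subsetI)
  fix m assume "m \<in> ray x k (box u Z)"
  then obtain w t where m: "m = u + w + Poly_Mapping.single x t" and w: "Poly_Mapping.keys w \<subseteq> Z"
    and t: "k \<le> t" unfolding ray_def box_def by blast
  have "m = (u + Poly_Mapping.single x k) + (w + Poly_Mapping.single x (t - k))"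
    unfolding m using t by (simp add: ac_simps flip: single_add)
  moreover have "Poly_Mapping.keys (w + Poly_Mapping.single x (t - k)) \<subseteq> insert x Z"
    using w by (auto simp: keys_plus_nat)
  ultimately show "m \<in> box (u + Poly_Mapping.single x k) (insert x Z)"
    unfolding box_def by blast
next
  fix m assume "m \<in> box (u + Poly_Mapping.single x k) (insert x Z)"
  then obtain w where m: "m = u + Poly_Mapping.single x k + w" and w: "Poly_Mapping.keys w \<subseteq> insert x Z"
    unfolding box_def by blast
  obtain v where v: "w = v + Poly_Mapping.single x (Poly_Mapping.lookup w x)"
    "Poly_Mapping.keys v = Poly_Mapping.keys w - {x}" by (rule minus_part)
  have "m = u + Poly_Mapping.single x k + (v + Poly_Mapping.single x (Poly_Mapping.lookup w x))"
    using m v(1) by simp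
  then have "m = (u + v) + Poly_Mapping.single x (k + Poly_Mapping.lookup w x)"
    by (simp add: single_add ac_simps)
  moreover have "u + v \<in> box u Z" using v(2) w unfolding box_def by blast
  ultimately show "m \<in> ray x k (box u Z)"
    unfolding ray_def by (metis (mono_tags, lifting) le_add1 mem_Collect_eq)
qed

lemma box_subset_keys:
  assumes "\<forall>b \<in> box u Z. Poly_Mapping.keys b \<subseteq> V"
  shows "Poly_Mapping.keys u \<subseteq> V" "Z \<subseteq> V"
proof -
  have "u + 0 \<in> box u Z" unfolding box_def by (intro CollectI exI[of _ 0]) simp
  then show "Poly_Mapping.keys u \<subseteq> V" using assms by fastforce
  show "Z \<subseteq> V"
  proof
    fix z assume "z \<in> Z"
    then have "u + Poly_Mapping.single z 1 \<in> box u Z"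
      unfolding box_def by (intro CollectI exI[of _ "Poly_Mapping.single z 1"]) simp
    then show "z \<in> V" using assms by (fastforce simp: keys_plus_nat)
  qed
qed

text \<open>A ray over a box is a box with one more free variable; this is how each induction step
gains a dimension.\<close>

lemma box_partition_ray:
  fixes x :: "'n::finite"
  assumes "box_partition d X" "\<forall>b\<in>X. Poly_Mapping.keys b \<subseteq> V" "x \<notin> V"
  shows "box_partition (Suc d) (ray x k X)"
  using assms
proof (induction rule: box_partition.induct)
  case (insert X Z u)
  have "x \<notin> Z" using box_subset_keys[of u Z V] insert by auto
  then have "box_partition (Suc d) (ray x k (box u Z))"
    using insert by (simp add: ray_box box_partition_box)
  moreover have "box_partition (Suc d) (ray x k X)" using insert by simp
  moreover have "ray x k X \<inter> ray x k (box u Z) = {}"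
    using insert by (intro ray_inter_empty[of _ _ V]) auto
  ultimately show ?case by (simp add: ray_Un box_partition_union)
qed (simp add: ray_def box_partition.empty)

section \<open>Intersections of irreducible ideals on exponent vectors\<close>

definition support :: "('n \<Rightarrow> nat) \<Rightarrow> 'n set"
  where "support c = {i. 0 < c i}"

text \<open>The exponent vectors of the irreducible ideal generated by the powers \<open>x\<^sub>i\<^bsup>c i\<^esup>\<close>, where \<open>c i = 0\<close> means
that there is no generator for \<open>i\<close>. The parameter \<open>V\<close> permits the same \<open>c\<close> to be used after some
variables have been removed.\<close>

definition irr :: "'n set \<Rightarrow> ('n \<Rightarrow> nat) \<Rightarrow> 'n monom set"
  where "irr V c = {m. \<exists>i\<in>V. 0 < c i \<and> c i \<le> Poly_Mapping.lookup m i}"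

definition monoms_on :: "'n set \<Rightarrow> 'n monom set"
  where "monoms_on V = {m. Poly_Mapping.keys m \<subseteq> V}"

lemma finite_bounded_monoms: "finite {m :: ('n::finite) monom. \<forall>i. Poly_Mapping.lookup m i \<le> N i}"
proof (rule finite_imageD)
  have "finite {f :: 'n \<Rightarrow> nat. \<forall>i. (i \<in> UNIV \<longrightarrow> f i \<in> {..Max (range N)}) \<and> (i \<notin> UNIV \<longrightarrow> f i = 0)}"
    by (rule finite_set_of_finite_funs) auto
  moreover have "Poly_Mapping.lookup ` {m. \<forall>i. Poly_Mapping.lookup m i \<le> N i} \<subseteq>
      {f :: 'n \<Rightarrow> nat. \<forall>i. (i \<in> UNIV \<longrightarrow> f i \<in> {..Max (range N)}) \<and> (i \<notin> UNIV \<longrightarrow> f i = 0)}"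
  proof (clarsimp, rule order_trans)
    fix m :: "'n monom" and i
    assume "\<forall>i. Poly_Mapping.lookup m i \<le> N i"
    then show "Poly_Mapping.lookup m i \<le> N i" by blast
    show "N i \<le> Max (range N)" by simp
  qed
  ultimately show "finite (Poly_Mapping.lookup ` {m :: 'n monom. \<forall>i. Poly_Mapping.lookup m i \<le> N i})"
    by (rule rev_finite_subset)
  show "inj_on Poly_Mapping.lookup {m :: 'n monom. \<forall>i. Poly_Mapping.lookup m i \<le> N i}"
    by (auto intro: inj_onI poly_mapping_eqI)
qed

lemma split_monom:
  fixes m :: "'n monom"
  obtains a b where "m = a + b" "Poly_Mapping.keys a \<subseteq> A" "Poly_Mapping.keys b \<inter> A = {}"
proof -
  define a where "a = (Abs_poly_mapping (\<lambda>i. Poly_Mapping.lookup m i when i \<in> A) :: 'n monom)"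
  have a: "Poly_Mapping.lookup a i = (Poly_Mapping.lookup m i when i \<in> A)" for i
  proof -
    have "finite {i. (Poly_Mapping.lookup m i when i \<in> A) \<noteq> 0}"
      by (rule finite_subset[OF _ finite_keys[of m]]) (auto simp: in_keys_iff when_def)
    then show ?thesis by (simp add: a_def)
  qed
  show ?thesis
  proof
    show "m = a + (m - a)"
      by (rule poly_mapping_eqI) (simp add: lookup_add lookup_minus a when_def)
  qed (auto simp: in_keys_iff lookup_minus a when_def split: if_splits)
qed

lemma irr_plus_irrelevant:
  fixes a b :: "'n monom"
  assumes "Poly_Mapping.keys b \<inter> support k = {}"
  shows "a + b \<in> irr V k \<longleftrightarrow> a \<in> irr V k"
proof -
  have "Poly_Mapping.lookup b i = 0" if "0 < k i" for i
    using that assms by (auto simp: in_keys_iff support_def)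
  then show ?thesis by (auto simp: irr_def lookup_add)
qed

lemma irr_plus_disjoint:
  fixes a b :: "'n monom"
  assumes "Poly_Mapping.keys a \<subseteq> A" "Poly_Mapping.keys b \<inter> A = {}"
  shows "a + b \<in> irr V c \<longleftrightarrow> a \<in> irr V c \<or> b \<in> irr (V - A) c"
proof -
  have a: "Poly_Mapping.lookup a i = 0" if "i \<notin> A" for i
    using that assms by (auto simp: in_keys_iff)
  have b: "Poly_Mapping.lookup b i = 0" if "i \<in> A" for i
    using that assms by (auto simp: in_keys_iff)
  have "(0 < c i \<and> c i \<le> Poly_Mapping.lookup (a + b) i) \<longleftrightarrow>
      (0 < c i \<and> c i \<le> Poly_Mapping.lookup a i) \<or> (i \<notin> A \<and> 0 < c i \<and> c i \<le> Poly_Mapping.lookup b i)" for i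
    by (cases "i \<in> A") (auto simp: lookup_add a b)
  then show ?thesis unfolding irr_def mem_Collect_eq by blast
qed

text \<open>Outside the ideal of \<open>k\<close> the exponents on \<open>support k\<close> are bounded by \<open>k\<close>. Splitting off that part \<open>a\<close> of a
monomial leaves a condition on the other variables only: those \<open>c\<close> that \<open>a\<close> does not
already satisfy must be satisfied there.\<close>

lemma slice_decomposition:
  fixes V :: "('n::finite) set"
  shows "{b \<in> monoms_on V. b \<notin> irr V k \<and> (\<forall>c\<in>S. b \<in> irr V c)} =
    (\<Union>a \<in> {a \<in> monoms_on (V \<inter> support k). a \<notin> irr V k}.
      (+) a ` {b \<in> monoms_on (V - support k). \<forall>c \<in> {c\<in>S. a \<notin> irr V c}. b \<in> irr (V - support k) c})"
    (is "?L = ?R")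
proof (intro equalityI subsetI)
  fix m assume m: "m \<in> ?L"
  obtain a b where ab: "m = a + b" "Poly_Mapping.keys a \<subseteq> support k" "Poly_Mapping.keys b \<inter> support k = {}"
    by (rule split_monom)
  have keys: "Poly_Mapping.keys a \<subseteq> V" "Poly_Mapping.keys b \<subseteq> V"
    using m unfolding ab(1) by (auto simp: monoms_on_def keys_plus_nat)
  have "a \<in> monoms_on (V \<inter> support k)" "a \<notin> irr V k"
    using m irr_plus_irrelevant[OF ab(3)] ab keys by (auto simp: monoms_on_def)
  moreover have "b \<in> monoms_on (V - support k)" using ab keys by (auto simp: monoms_on_def)
  moreover have "b \<in> irr (V - support k) c" if "c \<in> S" "a \<notin> irr V c" for c
    using that m irr_plus_disjoint[OF ab(2,3)] ab(1) by auto
  ultimately show "m \<in> ?R" using ab(1) by blast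
next
  fix m assume "m \<in> ?R"
  then obtain a b where a: "a \<in> monoms_on (V \<inter> support k)" "a \<notin> irr V k"
    and b: "b \<in> monoms_on (V - support k)" "\<forall>c \<in> {c\<in>S. a \<notin> irr V c}. b \<in> irr (V - support k) c"
    and m: "m = a + b" by blast
  have 1: "Poly_Mapping.keys a \<subseteq> support k" "Poly_Mapping.keys b \<inter> support k = {}"
    using a b by (auto simp: monoms_on_def)
  have "m \<in> monoms_on V" using a b by (auto simp: m monoms_on_def keys_plus_nat)
  then show "m \<in> ?L"
    using irr_plus_irrelevant[OF 1(2)] irr_plus_disjoint[OF 1] a(2) b(2) by (auto simp: m)
qed

lemma slice_pieces_disjoint:
  fixes a a' :: "'n monom"
  assumes "a \<in> monoms_on A" "a' \<in> monoms_on A" "a \<noteq> a'" "X \<subseteq> monoms_on (- A)" "Y \<subseteq> monoms_on (- A)"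
  shows "(+) a ` X \<inter> (+) a' ` Y = {}"
proof (rule ccontr)
  assume "(+) a ` X \<inter> (+) a' ` Y \<noteq> {}"
  then obtain b b' where b: "b \<in> X" "b' \<in> Y" "a + b = a' + b'" by auto
  have "Poly_Mapping.lookup a i = Poly_Mapping.lookup a' i" for i
  proof (cases "i \<in> A")
    case True
    then have "Poly_Mapping.lookup b i = 0" "Poly_Mapping.lookup b' i = 0"
      using b assms by (auto simp: monoms_on_def in_keys_iff subset_iff)
    then show ?thesis using arg_cong[OF b(3), of "\<lambda>m. Poly_Mapping.lookup m i"] by (simp add: lookup_add)
  next
    case False
    then have "i \<notin> Poly_Mapping.keys a" "i \<notin> Poly_Mapping.keys a'"
      using assms(1,2) unfolding monoms_on_def by blast+
    then show ?thesis by (simp add: in_keys_iff)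
  qed
  then show False using assms(3) poly_mapping_eqI by blast
qed

lemma finite_slice_index:
  fixes V :: "('n::finite) set"
  shows "finite {a \<in> monoms_on (V \<inter> support k). a \<notin> irr V k}"
proof (rule finite_subset[OF _ finite_bounded_monoms[of k]], safe)
  fix a :: "'n monom" and i assume a: "a \<in> monoms_on (V \<inter> support k)" "a \<notin> irr V k"
  show "Poly_Mapping.lookup a i \<le> k i"
  proof (cases "i \<in> V \<inter> support k")
    case True
    then show ?thesis using a(2) by (auto simp: irr_def support_def)
  next
    case False
    then have "i \<notin> Poly_Mapping.keys a" using a(1) unfolding monoms_on_def by blast
    then show ?thesis by (simp add: in_keys_iff)
  qed
qed

text \<open>For \<open>V = UNIV\<close> and supports that are not all empty, the largest such \<open>d\<close> is the number
\<open>v + (n - h)\<close> from the size: a variable that \<open>\<sigma>\<close> misses costs 1, whether or not some support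
contains it. Because \<open>\<sigma>\<close> need not cover everything, the bound drops by at most 1 when a single
variable or the whole support of a member of \<open>C\<close> is removed.\<close>

definition cover_bound :: "'n set \<Rightarrow> ('n \<Rightarrow> nat) set \<Rightarrow> nat \<Rightarrow> bool"
  where "cover_bound V C d \<longleftrightarrow> (\<forall>\<sigma>\<subseteq>C. d \<le> card \<sigma> + card (V - (\<Union>c\<in>\<sigma>. support c)))"

lemma cover_bound_remove_variable:
  fixes V :: "('n::finite) set"
  assumes "cover_bound V C d" "S \<subseteq> C"
  shows "cover_bound (V - {x}) S (d - 1)"
  unfolding cover_bound_def
proof (intro allI impI)
  fix \<sigma> assume "\<sigma> \<subseteq> S"
  then have "d \<le> card \<sigma> + card (V - (\<Union>c\<in>\<sigma>. support c))"
    using assms unfolding cover_bound_def by blast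
  also have "card (V - (\<Union>c\<in>\<sigma>. support c)) \<le> card (insert x (V - {x} - (\<Union>c\<in>\<sigma>. support c)))"
    by (rule card_mono) auto
  also have "\<dots> \<le> Suc (card (V - {x} - (\<Union>c\<in>\<sigma>. support c)))"
    by (rule card_insert_le_m1) auto
  finally show "d - 1 \<le> card \<sigma> + card (V - {x} - (\<Union>c\<in>\<sigma>. support c))" by simp
qed

text \<open>Adding \<open>k\<close> to a selection \<open>\<sigma>\<close> costs 1 and covers the variables of \<open>support k\<close>.\<close>

lemma cover_bound_remove_support:
  fixes V :: "('n::finite) set"
  assumes "cover_bound V C d" "S \<subseteq> C" "k \<in> C" "finite C"
  shows "cover_bound (V - support k) S (d - 1)"
  unfolding cover_bound_def
proof (intro allI impI)
  fix \<sigma> assume s: "\<sigma> \<subseteq> S"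
  have "d \<le> card (insert k \<sigma>) + card (V - (\<Union>c\<in>insert k \<sigma>. support c))"
    using assms(1) s assms(2,3) unfolding cover_bound_def by (metis insert_subset subset_trans)
  also have "V - (\<Union>c\<in>insert k \<sigma>. support c) = V - support k - (\<Union>c\<in>\<sigma>. support c)" by auto
  also have "card (insert k \<sigma>) \<le> Suc (card \<sigma>)"
    using s assms by (simp add: card_insert_if finite_subset)
  finally show "d - 1 \<le> card \<sigma> + card (V - support k - (\<Union>c\<in>\<sigma>. support c))" by simp
qed

lemma mem_irr_insert:
  fixes b :: "'n monom"
  assumes "b \<in> monoms_on V" "x \<notin> V"
  shows "b + Poly_Mapping.single x t \<in> irr (insert x V) c \<longleftrightarrow> b \<in> irr V c \<or> 0 < c x \<and> c x \<le> t"
proof -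
  have "Poly_Mapping.lookup b x = 0" using assms by (auto simp: monoms_on_def in_keys_iff)
  then show ?thesis using assms(2) by (auto simp: irr_def lookup_add lookup_single when_def)
qed

lemma plus_single_in_monoms_on:
  "b \<in> monoms_on V \<Longrightarrow> b + Poly_Mapping.single x t \<in> monoms_on (insert x V)" for b :: "'n monom"
  by (auto simp: monoms_on_def keys_plus_nat split: if_splits)

lemma monoms_on_insert_cases:
  fixes m :: "'n monom"
  assumes "m \<in> monoms_on (insert x V)" 
  obtains b t where "b \<in> monoms_on V" "m = b + Poly_Mapping.single x t"
proof (rule minus_part[of m x])
  fix v assume "m = v + Poly_Mapping.single x (Poly_Mapping.lookup m x)"
    "Poly_Mapping.keys v = Poly_Mapping.keys m - {x}"
  then show thesis using assms by (intro that[of v]) (auto simp: monoms_on_def)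
qed

text \<open>The combinatorial core of the theorem, by induction on the set of variables as explained at the
beginning.\<close>

lemma box_partition_intersection:
  fixes V :: "('n::finite) set"
  assumes "finite C" "cover_bound V C d"
  shows "box_partition d {m \<in> monoms_on V. \<forall>c\<in>C. m \<in> irr V c}"
  using finite[of V] assms
proof (induction V arbitrary: C d rule: finite_psubset_induct)
  case (psubset V)
  show ?case
  proof (cases "V = {}")
    case True
    have "d \<le> card ({} :: 'n set)" using psubset.prems True by (force simp: cover_bound_def)
    moreover have "box 0 {} = {0 :: 'n monom}" "monoms_on {} = {0 :: 'n monom}"
      by (auto simp: box_def monoms_on_def)
    ultimately have "box_partition d (monoms_on {} :: 'n monom set)"
      using box_partition_box[of d "{}" "0 :: 'n monom"] by simp
    then show ?thesis using True by (cases "C = {}") (auto simp: irr_def box_partition.empty)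
  next
    case False
    then obtain x where "x \<in> V" by blast
    define U where "U = V - {x}"
    have V: "V = insert x U" "x \<notin> U" "U \<subset> V" using \<open>x \<in> V\<close> by (auto simp: U_def)
    have ray_suc: "box_partition d (ray x l X)" if "box_partition (d - 1) X" "X \<subseteq> monoms_on U" for l X
    proof -
      have "box_partition (Suc (d - 1)) (ray x l X)"
        using that V(2) by (intro box_partition_ray[of _ _ U]) (auto simp: monoms_on_def)
      then show ?thesis by (rule box_partition_mono) simp
    qed
    have slice: "box_partition (d - 1) {b \<in> monoms_on U. b \<notin> irr U k \<and> (\<forall>c\<in>S. b \<in> irr U c)}"
      if k: "k \<in> C" "0 < k x" and S: "S \<subseteq> C" for k S
      unfolding slice_decomposition
    proof (rule box_partition_UN[OF finite_slice_index])
      fix a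
      let ?S = "{c \<in> S. a \<notin> irr U c}"
      have eq: "U - support k = V - support k" using k V by (auto simp: support_def)
      have "V - support k \<subset> V" using k \<open>x \<in> V\<close> by (auto simp: support_def)
      then have "box_partition (d - 1)
          {b \<in> monoms_on (U - support k). \<forall>c\<in>?S. b \<in> irr (U - support k) c}"
        unfolding eq using psubset.prems S k
        by (intro psubset.IH cover_bound_remove_support[of V C]) (auto intro: finite_subset)
      then show "box_partition (d - 1)
          ((+) a ` {b \<in> monoms_on (U - support k). \<forall>c\<in>?S. b \<in> irr (U - support k) c})"
        by (rule box_partition_translate)
    next
      fix a b :: "'n monom"
      assume "a \<in> {a \<in> monoms_on (U \<inter> support k). a \<notin> irr U k}"
        "b \<in> {a \<in> monoms_on (U \<inter> support k). a \<notin> irr U k}" "a \<noteq> b"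
      then show "(+) a ` {b \<in> monoms_on (U - support k). \<forall>c\<in>{c \<in> S. a \<notin> irr U c}. b \<in> irr (U - support k) c} \<inter>
        (+) b ` {ba \<in> monoms_on (U - support k). \<forall>c\<in>{c \<in> S. b \<notin> irr U c}. ba \<in> irr (U - support k) c} = {}"
        by (intro slice_pieces_disjoint[of _ "support k"]) (auto simp: monoms_on_def)
    qed
    have irrU: "b + Poly_Mapping.single x t \<in> irr U c \<longleftrightarrow> b \<in> irr U c" for b t c
      using V(2) by (auto simp: irr_def lookup_add lookup_single when_def)
    \<comment> \<open>The conditions in \<open>S\<close> have to hold off \<open>x\<close>. Moving the conditions of \<open>T\<close> to \<open>S\<close> in
      decreasing order of \<open>c x\<close> peels off, for each \<open>k\<close>, the lines whose ray starts at \<open>k x\<close>;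
      the order resolves ties.\<close>
    have main: "box_partition d {m \<in> monoms_on V. (\<forall>c\<in>S. m \<in> irr U c) \<and> (\<forall>c\<in>T. m \<in> irr V c)}"
      if "finite T" "T \<subseteq> {c\<in>C. 0 < c x}" "S \<subseteq> C" for T S
      using that
    proof (induction T arbitrary: S rule: finite_ranking_induct[where f = "\<lambda>c. c x"])
      case empty
      let ?D = "{b \<in> monoms_on U. \<forall>c\<in>S. b \<in> irr U c}"
      have "{m \<in> monoms_on V. \<forall>c\<in>S. m \<in> irr U c} = ray x 0 ?D"
      proof (intro equalityI subsetI)
        fix m assume m: "m \<in> {m \<in> monoms_on V. \<forall>c\<in>S. m \<in> irr U c}"
        then have "m \<in> monoms_on (insert x U)" by (simp add: V(1))
        then obtain b t where b: "b \<in> monoms_on U" "m = b + Poly_Mapping.single x t" by (rule monoms_on_insert_cases)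
        then have "b \<in> ?D" using m by (simp add: irrU)
        then show "m \<in> ray x 0 ?D" using b(2) unfolding ray_def by blast
      next
        fix m assume "m \<in> ray x 0 ?D"
        then show "m \<in> {m \<in> monoms_on V. \<forall>c\<in>S. m \<in> irr U c}"
          using V(1) by (auto simp: ray_def irrU plus_single_in_monoms_on)
      qed
      moreover have "box_partition (d - 1) ?D"
        using psubset.prems V empty unfolding U_def
        by (intro psubset.IH cover_bound_remove_variable[of V C]) (auto intro: finite_subset)
      ultimately show ?case by (auto intro: ray_suc)
    next
      case (insert k T)
      let ?D = "{b \<in> monoms_on U. b \<notin> irr U k \<and> (\<forall>c\<in>S. b \<in> irr U c)}"
      let ?A = "{m \<in> monoms_on V. (\<forall>c\<in>insert k S. m \<in> irr U c) \<and> (\<forall>c\<in>T. m \<in> irr V c)}"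
      have k: "k \<in> C" "0 < k x" using insert.prems by auto
      have "{m \<in> monoms_on V. (\<forall>c\<in>S. m \<in> irr U c) \<and> (\<forall>c\<in>insert k T. m \<in> irr V c)}
          = ?A \<union> ray x (k x) ?D"
      proof (intro equalityI subsetI)
        fix m assume m: "m \<in> {m \<in> monoms_on V. (\<forall>c\<in>S. m \<in> irr U c) \<and> (\<forall>c\<in>insert k T. m \<in> irr V c)}"
        then have "m \<in> monoms_on (insert x U)" by (simp add: V(1))
        then obtain b t where b: "b \<in> monoms_on U" "m = b + Poly_Mapping.single x t" by (rule monoms_on_insert_cases)
        show "m \<in> ?A \<union> ray x (k x) ?D"
        proof (cases "b \<in> irr U k")
          case True
          then show ?thesis using m by (auto simp: b(2) irrU)
        next
          case False
          moreover have "b + Poly_Mapping.single x t \<in> irr (insert x U) k"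
            using m by (simp add: b(2) V(1))
          ultimately have "k x \<le> t" using mem_irr_insert[OF b(1) V(2)] by blast
          moreover have "b \<in> ?D" using m False b by (auto simp: irrU)
          ultimately show ?thesis using b(2) unfolding ray_def by blast
        qed
      next
        fix m assume "m \<in> ?A \<union> ray x (k x) ?D"
        then show "m \<in> {m \<in> monoms_on V. (\<forall>c\<in>S. m \<in> irr U c) \<and> (\<forall>c\<in>insert k T. m \<in> irr V c)}"
        proof
          assume "m \<in> ?A"
          moreover have "irr U k \<subseteq> irr V k" using V(1) by (auto simp: irr_def)
          ultimately show ?thesis by auto
        next
          assume "m \<in> ray x (k x) ?D"
          then obtain b t where b: "b \<in> ?D" "k x \<le> t" and m: "m = b + Poly_Mapping.single x t"
            unfolding ray_def by blast
          have "b \<in> monoms_on U" using b by blast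
          \<comment> \<open>As \<open>k x\<close> is maximal, the exponent of \<open>x\<close> alone satisfies everything left in \<open>T\<close>.\<close>
          have "m \<in> irr V c" if "c \<in> insert k T" for c
          proof -
            have "0 < c x" "c x \<le> k x" using that insert.prems insert.hyps by auto
            then show ?thesis
              unfolding m V(1) mem_irr_insert[OF \<open>b \<in> monoms_on U\<close> V(2)] using b(2) by simp
          qed
          moreover have "m \<in> monoms_on V" using b by (simp add: m V(1) plus_single_in_monoms_on)
          ultimately show ?thesis using b(1) by (auto simp: m irrU)
        qed
      qed
      moreover have "box_partition d (ray x (k x) ?D)"
        using k insert.prems by (intro ray_suc slice) auto
      moreover have "box_partition d ?A" using insert.prems k by (intro insert.IH) auto
      moreover have "?A \<inter> ray x (k x) ?D = {}" by (auto simp: ray_def irrU)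
      ultimately show ?case by (simp add: box_partition_union)
    qed
    \<comment> \<open>A condition with \<open>c x = 0\<close> can only be satisfied off \<open>x\<close>, so it belongs to \<open>S\<close> from the start.\<close>
    have "{m \<in> monoms_on V. \<forall>c\<in>C. m \<in> irr V c} =
      {m \<in> monoms_on V. (\<forall>c\<in>{c\<in>C. c x = 0}. m \<in> irr U c) \<and> (\<forall>c\<in>{c\<in>C. 0 < c x}. m \<in> irr V c)}"
      using V by (auto simp: irr_def)
    then show ?thesis using main[of "{c\<in>C. 0 < c x}" "{c\<in>C. c x = 0}"] psubset.prems by auto
  qed
qed

section \<open>Monomial ideals and Stanley decompositions\<close>

definition supported :: "'n monom set \<Rightarrow> ('n, 'k::field) polys set"
  where "supported X = {p. Poly_Mapping.keys p \<subseteq> X}"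

definition restriction :: "'n monom set \<Rightarrow> ('n, 'k::field) polys \<Rightarrow> ('n, 'k) polys"
  where "restriction X p = (\<Sum>m\<in>Poly_Mapping.keys p \<inter> X. Poly_Mapping.single m (Poly_Mapping.lookup p m))"

lemma lookup_restriction:
  "Poly_Mapping.lookup (restriction X p) m = (Poly_Mapping.lookup p m when m \<in> X)"
proof -
  have "Poly_Mapping.lookup (restriction X p) m =
      (\<Sum>k\<in>Poly_Mapping.keys p \<inter> X. if k = m then Poly_Mapping.lookup p m else 0)"
    unfolding restriction_def lookup_sum by (rule sum.cong) (auto simp: lookup_single when_def)
  then show ?thesis by (simp add: sum.delta when_def in_keys_iff)
qed

lemma sum_of_terms:
  fixes p :: "('n, 'k::field) polys"
  shows "(\<Sum>m\<in>Poly_Mapping.keys p. Poly_Mapping.single m (Poly_Mapping.lookup p m)) = p"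
  using lookup_restriction[of UNIV p] by (intro poly_mapping_eqI) (simp add: restriction_def)

lemma lookup_times_single:
  fixes p :: "('n, 'k::field) polys"
  shows "Poly_Mapping.lookup (p * Poly_Mapping.single u c) (m + u) = Poly_Mapping.lookup p m * c"
proof -
  have "p * Poly_Mapping.single u c =
      (\<Sum>m\<in>Poly_Mapping.keys p. Poly_Mapping.single m (Poly_Mapping.lookup p m)) * Poly_Mapping.single u c"
    by (simp add: sum_of_terms)
  also have "\<dots> = (\<Sum>k\<in>Poly_Mapping.keys p. Poly_Mapping.single (k + u) (Poly_Mapping.lookup p k * c))"
    by (simp add: sum_distrib_right mult_single)
  finally have "Poly_Mapping.lookup (p * Poly_Mapping.single u c) (m + u) =
      (\<Sum>k\<in>Poly_Mapping.keys p. if k = m then Poly_Mapping.lookup p m * c else 0)"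
    unfolding lookup_sum by (auto simp: lookup_sum lookup_single when_def intro!: sum.cong)
  then show ?thesis by (simp add: sum.delta in_keys_iff)
qed

lemma keys_times_single:
  fixes p :: "('n, 'k::field) polys"
  assumes "c \<noteq> 0"
  shows "Poly_Mapping.keys (p * Poly_Mapping.single u c) = (\<lambda>m. m + u) ` Poly_Mapping.keys p"
proof (intro equalityI subsetI)
  fix m assume "m \<in> Poly_Mapping.keys (p * Poly_Mapping.single u c)"
  then show "m \<in> (\<lambda>m. m + u) ` Poly_Mapping.keys p"
    using keys_mult[of p "Poly_Mapping.single u c"] assms by auto
next
  fix m assume "m \<in> (\<lambda>m. m + u) ` Poly_Mapping.keys p"
  then show "m \<in> Poly_Mapping.keys (p * Poly_Mapping.single u c)"
    using assms by (auto simp: in_keys_iff lookup_times_single)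
qed

definition up_closed :: "'n monom set \<Rightarrow> bool"
  where "up_closed X \<longleftrightarrow> (\<forall>m\<in>X. \<forall>w. m + w \<in> X)"

lemma supported_zero: "0 \<in> supported X"
  by (simp add: supported_def)

lemma supported_empty: "supported {} = {0}"
  by (auto simp: supported_def)

lemma supported_add: "p \<in> supported X \<Longrightarrow> q \<in> supported X \<Longrightarrow> p + q \<in> supported X"
  using keys_add[of p q] by (auto simp: supported_def)

lemma supported_sum: "(\<And>i. i \<in> A \<Longrightarrow> p i \<in> supported X) \<Longrightarrow> sum p A \<in> supported X"
  by (induction A rule: infinite_finite_induct) (auto intro: supported_add supported_zero)

lemma supported_ideal:
  assumes "up_closed X"
  shows "is_ideal (supported X :: ('n, 'k::field) polys set)"
  unfolding module.subspace_def[OF module_times]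
proof (intro conjI ballI allI supported_zero supported_add)
  fix c p :: "('n, 'k) polys" assume p: "p \<in> supported X"
  show "c * p \<in> supported X"
    unfolding supported_def
  proof (intro CollectI subsetI)
    fix m assume "m \<in> Poly_Mapping.keys (c * p)"
    then obtain a b where "m = a + b" "b \<in> Poly_Mapping.keys p" using keys_mult[of c p] by blast
    then have "b + a \<in> X" using p assms unfolding supported_def up_closed_def by blast
    then show "m \<in> X" using \<open>m = a + b\<close> by (simp add: add.commute)
  qed
qed auto

lemma single_eq_times_monomial:
  "Poly_Mapping.single (u + w) c = Poly_Mapping.single w c * monomial u"
  by (simp add: monomial_def mult_single add.commute)

text \<open>Membership in a monomial ideal is decided monomial by monomial, so monomial ideals may be replaced by
up-closed sets of exponent vectors.\<close>

lemma ideal_gen_monomials: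
  "ideal_gen (monomial ` A) = (supported {a + w | a w. a \<in> A} :: ('n, 'k::field) polys set)"
proof
  let ?Y = "{a + w | a w. a \<in> A}"
  have up: "up_closed ?Y" unfolding up_closed_def
  proof safe
    fix a w v assume "a \<in> A"
    then show "\<exists>a' w'. a + w + v = a' + w' \<and> a' \<in> A"
      by (intro exI[of _ a] exI[of _ "w + v"]) (simp add: add.assoc)
  qed
  have "monomial a \<in> (supported ?Y :: ('n, 'k) polys set)" if "a \<in> A" for a
  proof -
    have "a + 0 \<in> ?Y" using that by blast
    then show ?thesis by (simp add: supported_def monomial_def)
  qed
  then show "ideal_gen (monomial ` A) \<subseteq> (supported ?Y :: ('n, 'k) polys set)"
    by (intro module.span_minimal[OF module_times] supported_ideal up) auto
  show "supported ?Y \<subseteq> (ideal_gen (monomial ` A) :: ('n, 'k) polys set)"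
  proof
    fix p :: "('n, 'k) polys" assume p: "p \<in> supported ?Y"
    have "(\<Sum>m\<in>Poly_Mapping.keys p. Poly_Mapping.single m (Poly_Mapping.lookup p m))
        \<in> ideal_gen (monomial ` A)"
    proof (rule module.span_sum[OF module_times])
      fix m assume "m \<in> Poly_Mapping.keys p"
      then obtain a w where "a \<in> A" "m = a + w" using p unfolding supported_def by blast
      then show "Poly_Mapping.single m (Poly_Mapping.lookup p m) \<in> ideal_gen (monomial ` A)"
        unfolding \<open>m = a + w\<close> single_eq_times_monomial
        by (intro module.span_scale[OF module_times] module.span_base[OF module_times] imageI)
    qed
    then show "p \<in> ideal_gen (monomial ` A)" by (simp add: sum_of_terms)
  qed
qed

lemma module_const_poly: "module (\<lambda>c. (*) (const_poly c :: ('n, 'k::field) polys))"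
proof unfold_locales
  fix a b :: 'k and x y :: "('n, 'k::field) polys"
  show "const_poly a * (x + y) = const_poly a * x + const_poly a * y" by (rule distrib_left)
  show "const_poly (a + b) * x = const_poly a * x + const_poly b * x"
    by (simp add: const_poly_def single_add distrib_right)
  show "const_poly a * (const_poly b * x) = const_poly (a * b) * x"
    by (simp add: const_poly_def mult_single flip: mult.assoc)
  show "const_poly 1 * x = x" by (simp add: const_poly_def)
qed

lemma stanley_space_monomial:
  "stanley_space (*) (monomial u) Z = (supported (box u Z) :: ('n, 'k::field) polys set)"
  unfolding stanley_space_def
proof
  interpret module "\<lambda>c. (*) (const_poly c :: ('n, 'k) polys)" by (rule module_const_poly)
  let ?B = "{monomial w * monomial u | w. Poly_Mapping.keys w \<subseteq> Z} :: ('n, 'k) polys set"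
  have "subspace (supported (box u Z) :: ('n, 'k) polys set)"
    unfolding subspace_def
  proof (intro conjI ballI allI supported_zero supported_add)
    fix c and p :: "('n, 'k) polys" assume "p \<in> supported (box u Z)"
    then show "const_poly c * p \<in> supported (box u Z)"
      using keys_mult[of "const_poly c" p] by (auto simp: supported_def const_poly_def split: if_splits)
  qed auto
  moreover have "?B \<subseteq> supported (box u Z)"
    by (auto simp: supported_def monomial_def mult_single box_def add.commute)
  ultimately show "span ?B \<subseteq> supported (box u Z)" by (intro span_minimal)
  show "supported (box u Z) \<subseteq> span ?B"
  proof
    fix p :: "('n, 'k) polys" assume p: "p \<in> supported (box u Z)"
    have "(\<Sum>m\<in>Poly_Mapping.keys p. Poly_Mapping.single m (Poly_Mapping.lookup p m)) \<in> span ?B"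
    proof (rule span_sum)
      fix m assume "m \<in> Poly_Mapping.keys p"
      then obtain w where w: "Poly_Mapping.keys w \<subseteq> Z" "m = u + w"
        using p unfolding supported_def box_def by blast
      have "Poly_Mapping.single m (Poly_Mapping.lookup p m) =
          const_poly (Poly_Mapping.lookup p m) * (monomial w * monomial u)"
        by (simp add: w(2) const_poly_def monomial_def mult_single add.commute)
      then show "Poly_Mapping.single m (Poly_Mapping.lookup p m) \<in> span ?B"
        using w(1) by (simp only:) (intro span_scale span_base, blast)
    qed
    then show "p \<in> span ?B" by (simp add: sum_of_terms)
  qed
qed

lemma box_partition_enumerate:
  assumes "box_partition d X"
  obtains m :: nat and u Z where "\<forall>i<m. d \<le> card (Z i)" "X = (\<Union>i<m. box (u i) (Z i))"
    "\<forall>i<m. \<forall>j<m. i \<noteq> j \<longrightarrow> box (u i) (Z i) \<inter> box (u j) (Z j) = {}"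
proof -
  have "\<exists>m u Z. (\<forall>i<m. d \<le> card (Z i)) \<and> X = (\<Union>i<(m::nat). box (u i) (Z i)) \<and>
      (\<forall>i<m. \<forall>j<m. i \<noteq> j \<longrightarrow> box (u i) (Z i) \<inter> box (u j) (Z j) = {})"
    using assms
  proof (induction rule: box_partition.induct)
    case empty
    show ?case by (rule exI[of _ 0]) simp
  next
    case (insert X Z' u')
    obtain m :: nat and u Z where IH: "\<forall>i<m. d \<le> card (Z i)" "X = (\<Union>i<m. box (u i) (Z i))"
      "\<forall>i<m. \<forall>j<m. i \<noteq> j \<longrightarrow> box (u i) (Z i) \<inter> box (u j) (Z j) = {}" using insert.IH by blast
    have "X \<union> box u' Z' = (\<Union>i<Suc m. box ((u(m := u')) i) ((Z(m := Z')) i))"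
      by (simp add: lessThan_Suc IH(2) Un_commute)
    moreover have "\<forall>i<Suc m. d \<le> card ((Z(m := Z')) i)" using IH insert by (simp add: less_Suc_eq)
    moreover have "\<forall>i<m. box (u i) (Z i) \<inter> box u' Z' = {}" using insert.hyps(3) IH(2) by blast
    then have "\<forall>i<Suc m. \<forall>j<Suc m. i \<noteq> j \<longrightarrow>
        box ((u(m := u')) i) ((Z(m := Z')) i) \<inter> box ((u(m := u')) j) ((Z(m := Z')) j) = {}"
      using IH(3) by (auto simp: less_Suc_eq)
    ultimately show ?case by blast
  qed
  then show thesis using that by blast
qed

text \<open>A polynomial supported on a disjoint union of boxes is the sum of its restrictions to
the boxes, and the summands are determined by their coefficients.\<close>

lemma stanley_decomposition_of_boxes:
  fixes u :: "nat \<Rightarrow> 'n monom"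
  assumes X: "X = (\<Union>i<m. box (u i) (Z i))"
    and disj: "\<forall>i<m. \<forall>j<m. i \<noteq> j \<longrightarrow> box (u i) (Z i) \<inter> box (u j) (Z j) = {}"
  shows "stanley_decomposition (*) poly_grading (supported X :: ('n, 'k::field) polys set)
    m (\<lambda>i. monomial (u i)) Z"
  unfolding stanley_decomposition_def stanley_space_monomial
proof (intro conjI)
  show "\<forall>i<m. monomial (u i) \<in> (supported X :: ('n, 'k) polys set) \<and>
      (\<exists>a. monomial (u i) \<in> (poly_grading a :: ('n, 'k) polys set))"
  proof (intro allI impI conjI)
    fix i assume "i < m"
    have "u i \<in> box (u i) (Z i)" unfolding box_def by (intro CollectI exI[of _ 0]) simp
    then show "monomial (u i) \<in> (supported X :: ('n, 'k) polys set)"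
      using \<open>i < m\<close> by (auto simp: X supported_def monomial_def)
    show "\<exists>a. monomial (u i) \<in> (poly_grading a :: ('n, 'k) polys set)"
      by (rule exI[of _ "\<lambda>j. int (Poly_Mapping.lookup (u i) j)"])
        (simp add: poly_grading_def monomial_def)
  qed
  show "\<forall>i<m. \<forall>p \<in> (poly_subring (Z i) :: ('n, 'k) polys set). p * monomial (u i) = 0 \<longrightarrow> p = 0"
  proof (intro allI ballI impI)
    fix i and p :: "('n, 'k) polys" assume "p * monomial (u i) = 0"
    then have "p \<in> supported {}"
      using keys_times_single[of 1 p "u i"] by (simp add: monomial_def supported_def)
    then show "p = 0" by (simp add: supported_empty)
  qed
  have coeff: "Poly_Mapping.lookup (\<Sum>j<m. y j) k = Poly_Mapping.lookup (y i) k"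
    if "\<forall>j<m. y j \<in> (supported (box (u j) (Z j)) :: ('n, 'k) polys set)" "i < m" "k \<in> box (u i) (Z i)" for y i k
  proof -
    have "Poly_Mapping.lookup (y j) k = 0" if "j \<in> {..<m} - {i}" for j
    proof -
      have "k \<notin> box (u j) (Z j)" using that \<open>i < m\<close> \<open>k \<in> box (u i) (Z i)\<close> disj by blast
      then have "k \<notin> Poly_Mapping.keys (y j)"
        using that \<open>\<forall>j<m. y j \<in> supported (box (u j) (Z j))\<close> by (auto simp: supported_def)
      then show ?thesis by (simp add: in_keys_iff)
    qed
    then have "(\<Sum>j<m. Poly_Mapping.lookup (y j) k) = (\<Sum>j\<in>{i}. Poly_Mapping.lookup (y j) k)"
      using \<open>i < m\<close> by (intro sum.mono_neutral_right) auto
    then show ?thesis by (simp add: lookup_sum)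
  qed
  show "supported X = {\<Sum>i<m. y i | y. \<forall>i<m. y i \<in> (supported (box (u i) (Z i)) :: ('n, 'k) polys set)}"
  proof (intro equalityI subsetI)
    fix p :: "('n, 'k) polys" assume p: "p \<in> supported X"
    define y where "y i = restriction (box (u i) (Z i)) p" for i
    have y: "\<forall>i<m. y i \<in> supported (box (u i) (Z i))"
      by (auto simp: y_def supported_def in_keys_iff lookup_restriction when_def split: if_splits)
    have "Poly_Mapping.lookup p k = Poly_Mapping.lookup (\<Sum>i<m. y i) k" for k
    proof (cases "k \<in> X")
      case True
      then obtain i where i: "i < m" "k \<in> box (u i) (Z i)" using X by auto
      show ?thesis unfolding coeff[OF y i] by (simp add: y_def lookup_restriction i)
    next
      case False
      then have "k \<notin> Poly_Mapping.keys p" using p by (auto simp: supported_def)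
      then show ?thesis by (simp add: lookup_sum y_def lookup_restriction in_keys_iff)
    qed
    then have "p = (\<Sum>i<m. y i)" by (rule poly_mapping_eqI)
    then show "p \<in> {\<Sum>i<m. y i | y. \<forall>i<m. y i \<in> supported (box (u i) (Z i))}" using y by blast
  next
    fix p assume "p \<in> {\<Sum>i<m. y i | y. \<forall>i<m. y i \<in> (supported (box (u i) (Z i)) :: ('n, 'k) polys set)}"
    then obtain y where y: "\<forall>i<m. y i \<in> (supported (box (u i) (Z i)) :: ('n, 'k) polys set)"
      "p = (\<Sum>i<m. y i)" by blast
    have "supported (box (u i) (Z i)) \<subseteq> (supported X :: ('n, 'k) polys set)" if "i < m" for i
      using that by (auto simp: supported_def X)
    then show "p \<in> supported X"
      unfolding y(2) using y(1) by (intro supported_sum) auto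
  qed
  show "\<forall>y. (\<forall>i<m. y i \<in> (supported (box (u i) (Z i)) :: ('n, 'k) polys set)) \<and> (\<Sum>i<m. y i) = 0 \<longrightarrow>
      (\<forall>i<m. y i = 0)"
  proof (intro allI impI, elim conjE)
    fix y :: "nat \<Rightarrow> ('n, 'k) polys" and i
    assume y: "\<forall>i<m. y i \<in> supported (box (u i) (Z i))" and 0: "(\<Sum>i<m. y i) = 0" and i: "i < m"
    show "y i = 0"
    proof (rule poly_mapping_eqI)
      fix k
      show "Poly_Mapping.lookup (y i) k = Poly_Mapping.lookup 0 k"
      proof (cases "k \<in> box (u i) (Z i)")
        case True
        then show ?thesis using coeff[OF y i True] 0 by simp
      next
        case False
        then have "k \<notin> Poly_Mapping.keys (y i)" using y i unfolding supported_def by blast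
        then show ?thesis by (simp add: in_keys_iff)
      qed
    qed
  qed
qed

text \<open>The maximum in the Stanley depth is over a finite set because the dimensions are at most the
number of variables. A nonzero module needs at least one summand, so that
every minimum is over a nonempty set.\<close>

lemma sdepth_lower_bound:
  fixes M :: "'m::ab_group_add set" and Z :: "nat \<Rightarrow> ('n::finite) set"
  assumes "M \<noteq> {0}" "stanley_decomposition scale gr M m u Z" "\<forall>i<m. d \<le> card (Z i)"
  shows "d \<le> sdepth scale gr M"
proof -
  let ?D = "{Min ((\<lambda>i. card (Z i)) ` {..<m}) | m u Z. stanley_decomposition scale gr M m u Z}"
  have pos: "0 < m'" if "stanley_decomposition scale gr M m' u' Z'" for m' u' Z'
    using that \<open>M \<noteq> {0}\<close> unfolding stanley_decomposition_def by (cases m') auto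
  have "?D \<subseteq> {..CARD('n)}"
  proof safe
    fix m' :: nat and u' and Z' :: "nat \<Rightarrow> 'n set" assume "stanley_decomposition scale gr M m' u' Z'"
    then have "Min ((\<lambda>i. card (Z' i)) ` {..<m'}) \<le> card (Z' 0)" using pos by (intro Min_le) auto
    also have "\<dots> \<le> CARD('n)" by (rule card_mono) auto
    finally show "Min ((\<lambda>i. card (Z' i)) ` {..<m'}) \<le> CARD('n)" .
  qed
  then have "finite ?D" by (rule finite_subset) simp
  then have "Min ((\<lambda>i. card (Z i)) ` {..<m}) \<le> sdepth scale gr M"
    unfolding sdepth_def using assms(2) by (intro Max_ge) auto
  moreover have "d \<le> Min ((\<lambda>i. card (Z i)) ` {..<m})"
    using pos[OF assms(2)] assms(3) by (intro Min.boundedI) auto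
  ultimately show ?thesis by simp
qed

lemma sdepth_ideal_ge_of_box_partition:
  fixes X :: "('n::finite) monom set"
  assumes "box_partition d X" "supported X \<noteq> ({0} :: ('n, 'k::field) polys set)"
  shows "d \<le> sdepth_ideal (supported X :: ('n, 'k) polys set)"
proof (rule box_partition_enumerate[OF assms(1)])
  fix m :: nat and u Z
  assume "\<forall>i<m. d \<le> card (Z i)" "X = (\<Union>i<m. box (u i) (Z i))"
    "\<forall>i<m. \<forall>j<m. i \<noteq> j \<longrightarrow> box (u i) (Z i) \<inter> box (u j) (Z j) = {}"
  then show ?thesis
    by (intro sdepth_lower_bound[OF assms(2) stanley_decomposition_of_boxes])
qed

section \<open>Irreducible monomial ideals are primary\<close>

text \<open>An additive weight that separates a given finite set of monomials supplies leading terms without a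
chosen order of the variables. Variables enter one at a time; the exponent of the new variable
becomes the leading digit in a base above all previous weights.\<close>

lemma exists_separating_weight:
  fixes F :: "('n::finite) monom set"
  assumes "finite F"
  obtains w :: "'n monom \<Rightarrow> nat" where "\<And>a b. w (a + b) = w a + w b" "inj_on w F"
proof -
  have "\<exists>w :: 'n monom \<Rightarrow> nat. (\<forall>a b. w (a + b) = w a + w b) \<and>
      (\<forall>a\<in>F. \<forall>b\<in>F. w a = w b \<longrightarrow> (\<forall>i\<in>V. Poly_Mapping.lookup a i = Poly_Mapping.lookup b i))" for V
    using finite[of V]
  proof (induction V rule: finite_induct)
    case empty
    show ?case by (rule exI[of _ "\<lambda>_. 0"]) simp
  next
    case (insert i V)
    then obtain w :: "'n monom \<Rightarrow> nat" where w: "\<And>a b. w (a + b) = w a + w b"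
      "\<And>a b j. a \<in> F \<Longrightarrow> b \<in> F \<Longrightarrow> w a = w b \<Longrightarrow> j \<in> V \<Longrightarrow>
        Poly_Mapping.lookup a j = Poly_Mapping.lookup b j"
      by blast
    define B where "B = Suc (Max (insert 0 (w ` F)))"
    have B: "w a < B" if "a \<in> F" for a
      using that assms by (auto simp: B_def less_Suc_eq_le)
    let ?w = "\<lambda>m. Poly_Mapping.lookup m i * B + w m"
    have "Poly_Mapping.lookup a j = Poly_Mapping.lookup b j"
      if ab: "a \<in> F" "b \<in> F" "?w a = ?w b" "j \<in> insert i V" for a b j
    proof -
      have "?w a mod B = w a" "?w b mod B = w b" using B[OF ab(1)] B[OF ab(2)] by simp_all
      then have wab: "w a = w b" using ab(3) by simp
      moreover have "Poly_Mapping.lookup a i = Poly_Mapping.lookup b i"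
        using ab(3) wab B[OF ab(1)] by simp
      ultimately show ?thesis using w(2)[OF ab(1,2) wab] ab(4) by blast
    qed
    moreover have "\<forall>a b. ?w (a + b) = ?w a + ?w b" by (simp add: w(1) lookup_add algebra_simps)
    ultimately show ?case by (intro exI[of _ ?w]) blast
  qed
  then obtain w :: "'n monom \<Rightarrow> nat" where w: "\<And>a b. w (a + b) = w a + w b"
    "\<And>a b j. a \<in> F \<Longrightarrow> b \<in> F \<Longrightarrow> w a = w b \<Longrightarrow> Poly_Mapping.lookup a j = Poly_Mapping.lookup b j"
    by (metis UNIV_I)
  have "inj_on w F" by (intro inj_onI poly_mapping_eqI w(2))
  with w(1) show thesis by (rule that)
qed

text \<open>The exponent vectors in the prime ideal generated by the variables of \<open>A\<close>.\<close>

definition meets :: "'n set \<Rightarrow> 'n monom set"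
  where "meets A = {m. \<exists>i\<in>A. 0 < Poly_Mapping.lookup m i}"

lemma up_closed_meets: "up_closed (meets A)"
  by (auto simp: up_closed_def meets_def lookup_add)

lemma up_closed_irr: "up_closed (irr V c)"
  by (fastforce simp: up_closed_def irr_def lookup_add)

lemma meets_plus: "a + b \<in> meets A \<longleftrightarrow> a \<in> meets A \<or> b \<in> meets A"
  by (auto simp: meets_def lookup_add)

lemma irr_subset_meets: "irr UNIV c \<subseteq> meets (support c)"
  by (auto simp: irr_def meets_def support_def)

lemma irr_plus_not_meets: "b \<notin> meets (support c) \<Longrightarrow> a + b \<in> irr UNIV c \<longleftrightarrow> a \<in> irr UNIV c"
  using irr_plus_irrelevant[of b c a UNIV] by (auto simp: meets_def in_keys_iff)

lemma lookup_times:
  fixes f g :: "('n, 'k::field) polys"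
  shows "Poly_Mapping.lookup (f * g) k =
    (\<Sum>(a, b)\<in>Poly_Mapping.keys f \<times> Poly_Mapping.keys g.
      Poly_Mapping.lookup f a * Poly_Mapping.lookup g b when a + b = k)"
proof -
  have "f * g =
      (\<Sum>a\<in>Poly_Mapping.keys f. Poly_Mapping.single a (Poly_Mapping.lookup f a)) *
      (\<Sum>b\<in>Poly_Mapping.keys g. Poly_Mapping.single b (Poly_Mapping.lookup g b))"
    by (simp add: sum_of_terms)
  also have "\<dots> = (\<Sum>(a, b)\<in>Poly_Mapping.keys f \<times> Poly_Mapping.keys g.
      Poly_Mapping.single (a + b) (Poly_Mapping.lookup f a * Poly_Mapping.lookup g b))"
    by (simp add: sum_product mult_single sum.cartesian_product)
  finally show ?thesis
    by (simp add: lookup_sum lookup_single split_beta)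
qed

text \<open>The common source of primality and primariness. Order monomials first by their degree in
\<open>A\<close>, then by a separating weight. Let \<open>a0\<close> be the lowest term of \<open>f\<close> outside \<open>X\<close> and \<open>b0\<close> the lowest
term of \<open>g\<close>. Then \<open>b0\<close> involves no variable of \<open>A\<close>, because some term of \<open>g\<close> has degree 0 in \<open>A\<close>; so
\<open>a0 + b0\<close> lies outside \<open>X\<close>, and nothing cancels the product of these two terms.\<close>

lemma times_not_supported:
  fixes f g :: "('n::finite, 'k::field) polys"
  assumes up: "up_closed X"
    and X: "\<And>a b. a \<notin> X \<Longrightarrow> b \<notin> meets A \<Longrightarrow> a + b \<notin> X"
    and f: "f \<notin> supported X" and g: "g \<notin> supported (meets A)"
  shows "f * g \<notin> supported X"
proof -
  let ?F = "Poly_Mapping.keys f \<union> Poly_Mapping.keys g"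
  obtain w :: "'n monom \<Rightarrow> nat" where w: "\<And>a b. w (a + b) = w a + w b" "inj_on w ?F"
    by (rule exists_separating_weight[of ?F]) auto
  define B where "B = Suc (Max (insert 0 (w ` ?F)))"
  have B: "w a < B" if "a \<in> ?F" for a
  proof -
    have "w a \<le> Max (insert 0 (w ` ?F))" using that by (intro Max_ge) auto
    then show ?thesis by (simp add: B_def)
  qed
  \<comment> \<open>The lexicographic combination of the degree in \<open>A\<close> and \<open>w\<close>: on the terms of \<open>f\<close> and \<open>g\<close> the
    weights \<open>w\<close> stay below \<open>B\<close>.\<close>
  define K where "K m = (\<Sum>i\<in>A. Poly_Mapping.lookup m i) * B + w m" for m
  have K_add: "K (a + b) = K a + K b" for a b
    by (simp add: K_def w(1) lookup_add sum.distrib algebra_simps)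
  have K_inj: "a = b" if "a \<in> ?F" "b \<in> ?F" "K a = K b" for a b
  proof -
    have "K a mod B = w a" "K b mod B = w b"
      using B[OF that(1)] B[OF that(2)] by (simp_all add: K_def)
    then show ?thesis using that w(2) by (metis inj_onD)
  qed
  have K_meets: "K a < B \<longleftrightarrow> a \<notin> meets A" if "a \<in> ?F" for a
  proof
    assume "K a < B"
    then have "(\<Sum>i\<in>A. Poly_Mapping.lookup a i) = 0" by (cases "\<Sum>i\<in>A. Poly_Mapping.lookup a i") (auto simp: K_def)
    then show "a \<notin> meets A" by (auto simp: meets_def)
  qed (use B that in \<open>auto simp: K_def meets_def\<close>)
  obtain a0 where a0: "a0 \<in> Poly_Mapping.keys f - X"
    "\<And>a. a \<in> Poly_Mapping.keys f - X \<Longrightarrow> K a0 \<le> K a"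
    using f arg_min_if_finite[of "Poly_Mapping.keys f - X" K]
    by (metis Diff_eq_empty_iff finite_Diff finite_keys mem_Collect_eq not_le supported_def)
  obtain b1 where b1: "b1 \<in> Poly_Mapping.keys g - meets A" using g by (auto simp: supported_def)
  then obtain b0 where b0: "b0 \<in> Poly_Mapping.keys g"
    "\<And>b. b \<in> Poly_Mapping.keys g \<Longrightarrow> K b0 \<le> K b"
    using arg_min_if_finite[of "Poly_Mapping.keys g" K] by (metis DiffD1 empty_iff finite_keys not_le)
  have "K b0 < B" using b0(2)[of b1] b1 K_meets[of b1] by auto
  then have "b0 \<notin> meets A" using K_meets[of b0] b0 by simp
  then have notX: "a0 + b0 \<notin> X" using X a0 by blast
  have unique: "a = a0 \<and> b = b0"
    if "a \<in> Poly_Mapping.keys f" "b \<in> Poly_Mapping.keys g" "a + b = a0 + b0" for a b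
  proof -
    have "a \<notin> X" using notX that(3) up unfolding up_closed_def by metis
    then have "K a0 \<le> K a" "K b0 \<le> K b" using a0(2) b0(2) that by auto
    moreover have "K a + K b = K a0 + K b0" using that(3) K_add by metis
    ultimately have "K a = K a0" "K b = K b0" by linarith+
    then show ?thesis using K_inj[of a a0] K_inj[of b b0] that a0(1) b0(1) by blast
  qed
  have "Poly_Mapping.lookup (f * g) (a0 + b0) =
      (\<Sum>(a, b)\<in>{(a0, b0)}. Poly_Mapping.lookup f a * Poly_Mapping.lookup g b when a + b = a0 + b0)"
    unfolding lookup_times
  proof (rule sum.mono_neutral_right)
    show "\<forall>p \<in> Poly_Mapping.keys f \<times> Poly_Mapping.keys g - {(a0, b0)}.
        (case p of (a, b) \<Rightarrow> Poly_Mapping.lookup f a * Poly_Mapping.lookup g b when a + b = a0 + b0) = 0"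
      using unique by (auto simp: when_def split: if_splits)
  qed (use a0 b0 in auto)
  also have "\<dots> \<noteq> 0" using a0 b0 by (simp add: in_keys_iff)
  finally have "a0 + b0 \<in> Poly_Mapping.keys (f * g)" by (simp add: in_keys_iff)
  then show ?thesis using notX unfolding supported_def by blast
qed

lemma one_in_supported_iff: "(1 :: ('n, 'k::field) polys) \<in> supported X \<longleftrightarrow> 0 \<in> X"
  by (simp add: supported_def)

lemma prime_ideal_meets: "prime_ideal (supported (meets A) :: ('n::finite, 'k::field) polys set)"
  unfolding prime_ideal_def
proof (intro conjI allI impI supported_ideal up_closed_meets)
  have "(1 :: ('n, 'k) polys) \<notin> supported (meets A)"
    unfolding one_in_supported_iff by (simp add: meets_def)
  then show "(supported (meets A) :: ('n, 'k) polys set) \<noteq> UNIV" by blast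
  fix f g :: "('n, 'k) polys" assume "f * g \<in> supported (meets A)"
  then show "f \<in> supported (meets A) \<or> g \<in> supported (meets A)"
    using times_not_supported[OF up_closed_meets, of A A f g] by (auto simp: meets_plus)
qed

lemma irr_ideal_quotient:
  fixes f g :: "('n::finite, 'k::field) polys"
  assumes "f * g \<in> supported (irr UNIV c)" "f \<notin> supported (irr UNIV c)"
  shows "g \<in> supported (meets (support c))"
  using times_not_supported[OF up_closed_irr[of UNIV c], of "support c" f g] assms
  by (auto simp: irr_plus_not_meets)

lemma ideal_one_imp_UNIV:
  assumes "is_ideal P" "1 \<in> P"
  shows "P = UNIV"
proof -
  have "x * 1 \<in> P" for x by (rule module.subspace_scale[OF module_times assms])
  then show ?thesis by auto
qed

lemma prime_ideal_power:
  assumes "prime_ideal P" "f ^ k \<in> P"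
  shows "f \<in> P"
  using assms(2)
proof (induction k)
  case 0
  then show ?case using assms(1) ideal_one_imp_UNIV[of P] by (auto simp: prime_ideal_def)
next
  case (Suc k)
  then show ?case using assms(1) unfolding prime_ideal_def by (metis power_Suc)
qed

lemma prime_ideal_radical_subset: "prime_ideal P \<Longrightarrow> J \<subseteq> P \<Longrightarrow> radical J \<subseteq> P"
  unfolding radical_def using prime_ideal_power by blast

lemma subset_radical: "J \<subseteq> radical J"
  proof
  fix f assume "f \<in> J"
  then have "f ^ 1 \<in> J" by simp
  then show "f \<in> radical J" unfolding radical_def by blast
qed

lemma radical_mono: "J \<subseteq> J' \<Longrightarrow> radical J \<subseteq> radical J'"
  unfolding radical_def by blast

lemma radical_ideal:
  assumes "is_ideal J"
  shows "is_ideal (radical J)"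
proof -
  interpret module "(*) :: 'a \<Rightarrow> 'a \<Rightarrow> 'a" by (rule module_times)
  show ?thesis
    unfolding subspace_def
  proof (intro conjI ballI allI)
    show "0 \<in> radical J" using subset_radical subspace_0[OF assms] by blast
    fix f g assume "f \<in> radical J" "g \<in> radical J"
    then obtain k l where kl: "f ^ k \<in> J" "g ^ l \<in> J" unfolding radical_def by blast
    have "(f + g) ^ (k + l) = (\<Sum>i\<le>k + l. of_nat ((k + l) choose i) * f ^ i * g ^ (k + l - i))"
      by (rule binomial_ring)
    also have "\<dots> \<in> J"
    proof (rule subspace_sum[OF assms])
      fix i assume "i \<in> {..k + l}"
      show "of_nat ((k + l) choose i) * f ^ i * g ^ (k + l - i) \<in> J"
      proof (cases "k \<le> i")
        case True
        then have split: "f ^ i = f ^ (i - k) * f ^ k" by (simp flip: power_add)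
        have "of_nat ((k + l) choose i) * f ^ i * g ^ (k + l - i) =
            (of_nat ((k + l) choose i) * f ^ (i - k) * g ^ (k + l - i)) * f ^ k"
          unfolding split by (simp only: mult_ac)
        then show ?thesis using subspace_scale[OF assms kl(1)] by metis
      next
        case False
        then have "k + l - i = (k - i) + l" by simp
        then have split: "g ^ (k + l - i) = g ^ (k - i) * g ^ l" by (simp only: power_add)
        have "of_nat ((k + l) choose i) * f ^ i * g ^ (k + l - i) =
            (of_nat ((k + l) choose i) * f ^ i * g ^ (k - i)) * g ^ l"
          unfolding split by (simp only: mult_ac)
        then show ?thesis using subspace_scale[OF assms kl(2)] by metis
      qed
    qed
    finally show "f + g \<in> radical J" unfolding radical_def by blast
  next
    fix c f assume "f \<in> radical J"
    then obtain k where "f ^ k \<in> J" unfolding radical_def by blast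
    then have "(c * f) ^ k \<in> J" using subspace_scale[OF assms] by (simp add: power_mult_distrib)
    then show "c * f \<in> radical J" unfolding radical_def by blast
  qed
qed

definition variable :: "'n \<Rightarrow> ('n, 'k::field) polys"
  where "variable i = monomial (Poly_Mapping.single i 1)"

lemma variable_power: "variable i ^ k = monomial (Poly_Mapping.single i k)"
proof (induction k)
  case (Suc k)
  then show ?case by (simp add: variable_def monomial_def mult_single flip: single_add)
qed (simp add: monomial_def)

lemma variable_in_meets_iff: "(variable i :: ('n, 'k::field) polys) \<in> supported (meets A) \<longleftrightarrow> i \<in> A"
  by (auto simp: variable_def monomial_def supported_def meets_def lookup_single when_def)

lemma supported_meets_subset_iff:
  "(supported (meets A) :: ('n, 'k::field) polys set) \<subseteq> supported (meets B) \<longleftrightarrow> A \<subseteq> B"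
proof
  assume "(supported (meets A) :: ('n, 'k::field) polys set) \<subseteq> supported (meets B)"
  then show "A \<subseteq> B" by (metis subset_iff variable_in_meets_iff)
next
  assume "A \<subseteq> B"
  then have "meets A \<subseteq> meets B" by (auto simp: meets_def)
  then show "(supported (meets A) :: ('n, 'k::field) polys set) \<subseteq> supported (meets B)"
    by (auto simp: supported_def)
qed

lemma supported_meets_eq_iff:
  "(supported (meets A) :: ('n, 'k::field) polys set) = supported (meets B) \<longleftrightarrow> A = B"
  using supported_meets_subset_iff[of A B, where 'k='k] supported_meets_subset_iff[of B A, where 'k='k]
  by auto

text \<open>The ideal on the left is generated by the variables of \<open>A\<close>.\<close>

lemma supported_meets_subset_ideal:
  fixes J :: "('n, 'k::field) polys set"
  assumes "is_ideal J" "\<And>i. i \<in> A \<Longrightarrow> variable i \<in> J"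
  shows "supported (meets A) \<subseteq> J"
proof
  interpret module "(*) :: ('n, 'k) polys \<Rightarrow> ('n, 'k) polys \<Rightarrow> ('n, 'k) polys" by (rule module_times)
  fix p :: "('n, 'k) polys" assume p: "p \<in> supported (meets A)"
  have "(\<Sum>m\<in>Poly_Mapping.keys p. Poly_Mapping.single m (Poly_Mapping.lookup p m)) \<in> J"
  proof (rule subspace_sum[OF assms(1)])
    fix m assume "m \<in> Poly_Mapping.keys p"
    then obtain i where i: "i \<in> A" "0 < Poly_Mapping.lookup m i"
      using p unfolding supported_def meets_def by blast
    have "m = Poly_Mapping.single i 1 + (m - Poly_Mapping.single i 1)"
      using i(2) by (intro poly_mapping_eqI) (auto simp: lookup_add lookup_minus lookup_single when_def)
    then have "Poly_Mapping.single m (Poly_Mapping.lookup p m) =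
        Poly_Mapping.single (m - Poly_Mapping.single i 1) (Poly_Mapping.lookup p m) * variable i"
      using single_eq_times_monomial[of "Poly_Mapping.single i 1" "m - Poly_Mapping.single i 1"]
      unfolding variable_def by metis
    then show "Poly_Mapping.single m (Poly_Mapping.lookup p m) \<in> J"
      using subspace_scale[OF assms(1) assms(2)[OF i(1)]] by metis
  qed
  then show "p \<in> J" by (simp add: sum_of_terms)
qed

lemma variable_power_in_irr:
  "0 < c i \<Longrightarrow> variable i ^ c i \<in> (supported (irr UNIV c) :: ('n, 'k::field) polys set)"
  by (auto simp: variable_power monomial_def supported_def irr_def lookup_single when_def)

lemma radical_irr:
  "radical (supported (irr UNIV c) :: ('n::finite, 'k::field) polys set) = supported (meets (support c))"
proof
  have "supported (irr UNIV c) \<subseteq> (supported (meets (support c)) :: ('n, 'k) polys set)"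
    using irr_subset_meets[of c] by (auto simp: supported_def)
  then show "radical (supported (irr UNIV c)) \<subseteq> (supported (meets (support c)) :: ('n, 'k) polys set)"
    by (rule prime_ideal_radical_subset[OF prime_ideal_meets])
  show "(supported (meets (support c)) :: ('n, 'k) polys set) \<subseteq> radical (supported (irr UNIV c))"
  proof (intro supported_meets_subset_ideal radical_ideal supported_ideal up_closed_irr)
    fix i assume "i \<in> support c"
    then have "variable i ^ c i \<in> (supported (irr UNIV c) :: ('n, 'k) polys set)"
      by (intro variable_power_in_irr) (simp add: support_def)
    then show "variable i \<in> radical (supported (irr UNIV c) :: ('n, 'k) polys set)"
      unfolding radical_def by blast
  qed
qed

lemma primary_ideal_irr: "primary_ideal (supported (irr UNIV c) :: ('n::finite, 'k::field) polys set)"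
  unfolding primary_ideal_def radical_irr
proof (intro conjI allI impI supported_ideal up_closed_irr)
  have "(1 :: ('n, 'k) polys) \<notin> supported (irr UNIV c)"
    unfolding one_in_supported_iff by (auto simp: irr_def)
  then show "(supported (irr UNIV c) :: ('n, 'k) polys set) \<noteq> UNIV" by blast
qed (use irr_ideal_quotient in blast)

lemma monomial_ideal_supported:
  assumes "up_closed X"
  shows "monomial_ideal (supported X :: ('n, 'k::field) polys set)"
proof -
  have "{a + w | a w. a \<in> X} = X"
  proof (intro equalityI subsetI)
    fix m assume "m \<in> X"
    then have "m + 0 \<in> {a + w | a w. a \<in> X}" by blast
    then show "m \<in> {a + w | a w. a \<in> X}" by simp
  qed (use assms in \<open>auto simp: up_closed_def\<close>)
  then show ?thesis
    unfolding monomial_ideal_def by (intro exI[of _ X]) (simp add: ideal_gen_monomials)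
qed

lemma prime_ideal_prod:
  assumes "prime_ideal P" "finite A" "\<And>a. a \<in> A \<Longrightarrow> f a \<notin> P"
  shows "prod f A \<notin> P"
  using assms(2,3)
proof (induction A rule: finite_induct)
  case empty
  then show ?case using assms(1) ideal_one_imp_UNIV[of P] by (auto simp: prime_ideal_def)
next
  case (insert a A)
  then show ?case using assms(1) unfolding prime_ideal_def by auto
qed

text \<open>An associated prime \<open>I : f\<close> is the intersection of the quotients \<open>Q\<^sub>c : f\<close>, and being prime it contains,
hence equals, one of them; that one contains a power of each variable in \<open>support c\<close> and is
contained in the radical of \<open>Q\<^sub>c\<close>, so it is the prime generated by these variables. Conversely,
take a monomial that only \<open>Q\<^sub>k\<close> lacks and raise its exponents on \<open>support k\<close> to \<open>k - 1\<close>. It stays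
outside \<open>Q\<^sub>k\<close>, but every variable in \<open>support k\<close> multiplies it into \<open>I\<close>.\<close>

lemma Ass_quot_intersection_irr:
  fixes C :: "('n::finite \<Rightarrow> nat) set"
  assumes "finite C"
    and irredundant: "\<And>k. k \<in> C \<Longrightarrow> \<exists>m. (\<forall>c\<in>C - {k}. m \<in> irr UNIV c) \<and> m \<notin> irr UNIV k"
  shows "Ass_quot (supported {m. \<forall>c\<in>C. m \<in> irr UNIV c} :: ('n, 'k::field) polys set) =
    (\<lambda>c. supported (meets (support c))) ` C"
proof (intro equalityI subsetI)
  let ?I = "supported {m. \<forall>c\<in>C. m \<in> irr UNIV c} :: ('n, 'k) polys set"
  have I: "p \<in> ?I \<longleftrightarrow> (\<forall>c\<in>C. p \<in> supported (irr UNIV c))" for p :: "('n, 'k) polys"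
    by (auto simp: supported_def)
  fix P assume "P \<in> Ass_quot ?I"
  then obtain f where P: "prime_ideal P" "P = {g. g * f \<in> ?I}" unfolding Ass_quot_def by blast
  have "\<exists>c\<in>C. \<forall>g. g * f \<in> supported (irr UNIV c) \<longrightarrow> g \<in> P"
  proof (rule ccontr)
    assume "\<not> ?thesis"
    then obtain g where g: "\<And>c. c \<in> C \<Longrightarrow> g c * f \<in> supported (irr UNIV c)" "\<And>c. c \<in> C \<Longrightarrow> g c \<notin> P"
      by metis
    have "prod g C * f \<in> supported (irr UNIV c)" if "c \<in> C" for c
    proof -
      have "prod g C * f = prod g (C - {c}) * (g c * f)"
        using that \<open>finite C\<close> by (simp add: prod.remove mult_ac)
      then show ?thesis
        using module.subspace_scale[OF module_times supported_ideal[OF up_closed_irr] g(1)[OF that]]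
        by metis
    qed
    then have "prod g C \<in> P" using P(2) I by blast
    then show False using prime_ideal_prod[OF P(1) \<open>finite C\<close>] g(2) by blast
  qed
  then obtain c where c: "c \<in> C" "\<And>g. g * f \<in> supported (irr UNIV c) \<Longrightarrow> g \<in> P" by blast
  have "1 \<notin> P" using P(1) ideal_one_imp_UNIV[of P] by (auto simp: prime_ideal_def)
  then have "f \<notin> supported (irr UNIV c)" using c(2)[of 1] by auto
  then have "P \<subseteq> supported (meets (support c))"
    using P(2) I c(1) irr_ideal_quotient[of f _ c] by (auto simp: mult.commute)
  moreover have "supported (meets (support c)) \<subseteq> P"
  proof (rule supported_meets_subset_ideal)
    show "is_ideal P" using P(1) by (simp add: prime_ideal_def)
    fix i assume "i \<in> support c"
    then have "variable i ^ c i \<in> (supported (irr UNIV c) :: ('n, 'k) polys set)"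
      by (intro variable_power_in_irr) (simp add: support_def)
    then have "f * variable i ^ c i \<in> supported (irr UNIV c)"
      by (rule module.subspace_scale[OF module_times supported_ideal[OF up_closed_irr]])
    then have "variable i ^ c i \<in> P" using c(2) by (simp add: mult.commute)
    then show "variable i \<in> P" by (rule prime_ideal_power[OF P(1)])
  qed
  ultimately show "P \<in> (\<lambda>c. supported (meets (support c))) ` C" using c(1) by blast
next
  let ?I = "supported {m. \<forall>c\<in>C. m \<in> irr UNIV c} :: ('n, 'k) polys set"
  fix P assume "P \<in> (\<lambda>c. supported (meets (support c)) :: ('n, 'k) polys set) ` C"
  then obtain k where k: "k \<in> C" "P = supported (meets (support k))" by blast
  obtain m where m: "\<And>c. c \<in> C - {k} \<Longrightarrow> m \<in> irr UNIV c" "m \<notin> irr UNIV k"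
    using irredundant[OF k(1)] by blast
  define u where "u = Abs_poly_mapping (\<lambda>i. if 0 < k i then k i - 1 else Poly_Mapping.lookup m i)"
  have u: "Poly_Mapping.lookup u i = (if 0 < k i then k i - 1 else Poly_Mapping.lookup m i)" for i
    unfolding u_def by (subst lookup_Abs_poly_mapping) auto
  have mu: "Poly_Mapping.lookup m i \<le> Poly_Mapping.lookup u i" for i
  proof (cases "0 < k i")
    case True
    then have "Poly_Mapping.lookup m i < k i" using m(2) unfolding irr_def by (simp add: not_le) (metis not_gr0)
    then show ?thesis using True by (simp add: u)
  qed (simp add: u)
  have "a + u \<in> irr UNIV c" if "c \<in> C - {k}" for a c
  proof -
    obtain i where "0 < c i" "c i \<le> Poly_Mapping.lookup m i"
      using m(1)[OF \<open>c \<in> C - {k}\<close>] unfolding irr_def by blast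
    then show ?thesis using mu[of i] by (auto simp: irr_def lookup_add intro!: exI[of _ i])
  qed
  moreover have "a + u \<in> irr UNIV k \<longleftrightarrow> a \<in> meets (support k)" for a
  proof -
    have "k i \<le> Poly_Mapping.lookup (a + u) i \<longleftrightarrow> 0 < Poly_Mapping.lookup a i" if "0 < k i" for i
      using that by (auto simp: lookup_add u)
    then show ?thesis by (auto simp: irr_def meets_def support_def)
  qed
  ultimately have "(\<forall>c\<in>C. a + u \<in> irr UNIV c) \<longleftrightarrow> a \<in> meets (support k)" for a
    using k(1) by (metis DiffI singletonD)
  then have "P = {g. g * monomial u \<in> ?I}"
    by (auto simp: k(2) supported_def monomial_def keys_times_single)
  moreover have "prime_ideal P" unfolding k(2) by (rule prime_ideal_meets)
  ultimately show "P \<in> Ass_quot ?I" unfolding Ass_quot_def by blast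
qed

section \<open>Finite irreducible decompositions\<close>

lemma nat_seq_nondecreasing_subseq:
  fixes a :: "nat \<Rightarrow> nat"
  obtains r :: "nat \<Rightarrow> nat" where "strict_mono r" "\<And>i j. i \<le> j \<Longrightarrow> a (r i) \<le> a (r j)"
proof -
  obtain f where f: "strict_mono f" "monoseq (\<lambda>n. a (f n))" using seq_monosub by blast
  from f(2) show thesis
    unfolding monoseq_def
  proof
    assume "\<forall>m. \<forall>n\<ge>m. a (f m) \<le> a (f n)"
    then show thesis using that[of f] f(1) by blast
  next
    assume decr: "\<forall>m. \<forall>n\<ge>m. a (f n) \<le> a (f m)"
    \<comment> \<open>A nonincreasing sequence of natural numbers is constant from some \<open>n0\<close> on.\<close>
    define L where "L = (LEAST l. \<exists>n. a (f n) = l)"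
    have "\<exists>n. a (f n) = L" unfolding L_def by (rule LeastI) blast
    then obtain n0 where n0: "a (f n0) = L" by blast
    have "a (f (n0 + i)) = L" for i
    proof (rule antisym)
      show "a (f (n0 + i)) \<le> L" using decr n0 by (metis le_add1)
      show "L \<le> a (f (n0 + i))" unfolding L_def by (rule Least_le) blast
    qed
    moreover have "strict_mono (\<lambda>i. f (n0 + i))" using f(1) by (simp add: strict_mono_def)
    ultimately show thesis using that[of "\<lambda>i. f (n0 + i)"] by simp
  qed
qed

text \<open>Some subsequence is nondecreasing in every coordinate; it is found by passing to
subsequences for one coordinate after the other.\<close>

lemma dickson:
  fixes s :: "nat \<Rightarrow> ('n::finite) monom"
  obtains i j where "i < j" "\<And>x. Poly_Mapping.lookup (s i) x \<le> Poly_Mapping.lookup (s j) x"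
proof -
  have "\<exists>r :: nat \<Rightarrow> nat. strict_mono r \<and> (\<forall>x\<in>V. \<forall>i j. i \<le> j \<longrightarrow>
      Poly_Mapping.lookup (s (r i)) x \<le> Poly_Mapping.lookup (s (r j)) x)" for V
    using finite[of V]
  proof (induction V rule: finite_induct)
    case empty
    show ?case by (rule exI[of _ id]) (simp add: strict_mono_def)
  next
    case (insert x V)
    then obtain r :: "nat \<Rightarrow> nat" where r: "strict_mono r" "\<And>x i j. x \<in> V \<Longrightarrow> i \<le> j \<Longrightarrow>
      Poly_Mapping.lookup (s (r i)) x \<le> Poly_Mapping.lookup (s (r j)) x" by blast
    define a where "a n = Poly_Mapping.lookup (s (r n)) x" for n
    obtain q :: "nat \<Rightarrow> nat" where q: "strict_mono q" "\<And>i j. i \<le> j \<Longrightarrow> a (q i) \<le> a (q j)"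
      using nat_seq_nondecreasing_subseq[of a] by blast
    have "strict_mono (r \<circ> q)" using r(1) q(1) by (simp add: strict_mono_def)
    moreover have "Poly_Mapping.lookup (s ((r \<circ> q) i)) y \<le> Poly_Mapping.lookup (s ((r \<circ> q) j)) y"
      if "y \<in> insert x V" "i \<le> j" for y i j
      using that r(2)[of y "q i" "q j"] q(2)[of i j, unfolded a_def] strict_mono_leD[OF q(1)] by auto
    ultimately show ?case by (intro exI[of _ "r \<circ> q"]) blast
  qed
  from this[of UNIV] obtain r :: "nat \<Rightarrow> nat" where r: "strict_mono r" "\<And>x i j. i \<le> j \<Longrightarrow>
      Poly_Mapping.lookup (s (r i)) x \<le> Poly_Mapping.lookup (s (r j)) x" by blast
  show thesis
  proof (rule that)
    show "r 0 < r 1" using r(1) by (simp add: strict_mono_def)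
  qed (use r(2)[of 0 1] in simp)
qed

text \<open>By Dickson's lemma there are only finitely many minimal elements, so a single \<open>N\<close> bounds
their exponents.\<close>

lemma bounded_generators:
  fixes X :: "('n::finite) monom set"
  obtains N where "\<And>m. m \<in> X \<Longrightarrow> \<exists>g\<in>X. \<forall>i. Poly_Mapping.lookup g i \<le> Poly_Mapping.lookup m i \<and>
    Poly_Mapping.lookup g i \<le> N"
proof -
  let ?le = "\<lambda>g m :: 'n monom. \<forall>i. Poly_Mapping.lookup g i \<le> Poly_Mapping.lookup m i"
  define G where "G = {g \<in> X. \<forall>h\<in>X. ?le h g \<longrightarrow> h = g}"
  have "finite G"
  proof (rule ccontr)
    assume "infinite G"
    then obtain s :: "nat \<Rightarrow> 'n monom" where s: "inj s" "range s \<subseteq> G"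
      using infinite_countable_subset by blast
    obtain i j where ij: "i < j" "\<And>x. Poly_Mapping.lookup (s i) x \<le> Poly_Mapping.lookup (s j) x"
      by (rule dickson[of s]) blast
    have "s i = s j" using s(2) ij(2) unfolding G_def by blast
    then show False using s(1) ij(1) by (simp add: inj_eq)
  qed
  have below: "\<exists>g\<in>G. ?le g m" if "m \<in> X" for m
    using that
  proof (induction "\<Sum>i\<in>UNIV. Poly_Mapping.lookup m i" arbitrary: m rule: less_induct)
    case less
    show ?case
    proof (cases "m \<in> G")
      case False
      then obtain h where h: "h \<in> X" "?le h m" "h \<noteq> m" using less.prems unfolding G_def by blast
      then obtain i where "Poly_Mapping.lookup h i \<noteq> Poly_Mapping.lookup m i"
        using poly_mapping_eqI[of h m] by blast
      then have "Poly_Mapping.lookup h i < Poly_Mapping.lookup m i" using h(2) by (simp add: le_neq_implies_less)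
      then have "(\<Sum>i\<in>UNIV. Poly_Mapping.lookup h i) < (\<Sum>i\<in>UNIV. Poly_Mapping.lookup m i)"
        using h(2) by (intro sum_strict_mono_ex1) auto
      then obtain g where "g \<in> G" "?le g h" using less.hyps h(1) by blast
      then have "?le g m" using h(2) le_trans by blast
      then show ?thesis using \<open>g \<in> G\<close> by blast
    qed blast
  qed
  define N where "N = Max ((\<lambda>(g, i). Poly_Mapping.lookup g i) ` (G \<times> UNIV))"
  have "Poly_Mapping.lookup g i \<le> N" if "g \<in> G" for g i
  proof -
    have "Poly_Mapping.lookup g i \<in> (\<lambda>(g, i). Poly_Mapping.lookup g i) ` (G \<times> UNIV)"
      using that by (intro image_eqI[of _ _ "(g, i)"]) auto
    then show ?thesis unfolding N_def using \<open>finite G\<close> by (intro Max_ge) auto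
  qed
  then have "\<exists>g\<in>X. \<forall>i. Poly_Mapping.lookup g i \<le> Poly_Mapping.lookup m i \<and> Poly_Mapping.lookup g i \<le> N"
    if "m \<in> X" for m
    using below[OF that] unfolding G_def by blast
  then show thesis by (rule that)
qed

text \<open>Let \<open>N\<close> bound the exponents of the generators. A monomial \<open>m\<close> outside \<open>X\<close> is excluded by the irreducible
ideal with exponent \<open>m i + 1\<close> at those \<open>i\<close> where \<open>m i < N\<close>, and this ideal contains \<open>X\<close>: a generator
outside it would divide \<open>m\<close>. So the finitely many irreducible ideals that contain \<open>X\<close> and have
exponents at most \<open>N\<close> suffice, and a subset of least cardinality is irredundant.\<close>

lemma irreducible_decomposition:
  fixes X :: "('n::finite) monom set"
  assumes "up_closed X"
  obtains C where "finite C" "X = {m. \<forall>c\<in>C. m \<in> irr UNIV c}"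
    "\<And>k. k \<in> C \<Longrightarrow> \<exists>m. (\<forall>c\<in>C - {k}. m \<in> irr UNIV c) \<and> m \<notin> irr UNIV k"
proof -
  let ?cap = "\<lambda>C. {m :: 'n monom. \<forall>c\<in>C. m \<in> irr UNIV c}"
  obtain N where N: "\<And>m. m \<in> X \<Longrightarrow> \<exists>g\<in>X. \<forall>i. Poly_Mapping.lookup g i \<le> Poly_Mapping.lookup m i \<and>
    Poly_Mapping.lookup g i \<le> N" by (rule bounded_generators[of X]) blast
  define D :: "('n \<Rightarrow> nat) set" where "D = {c. X \<subseteq> irr UNIV c \<and> (\<forall>i. c i \<le> N)}"
  have "finite {c :: 'n \<Rightarrow> nat. \<forall>i. (i \<in> UNIV \<longrightarrow> c i \<in> {..N}) \<and> (i \<notin> UNIV \<longrightarrow> c i = 0)}"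
    by (rule finite_set_of_finite_funs) auto
  then have "finite D" by (rule rev_finite_subset) (auto simp: D_def)
  have "X = ?cap D"
  proof (intro equalityI subsetI)
    fix m assume m: "m \<in> ?cap D"
    show "m \<in> X"
    proof (rule ccontr)
      assume "m \<notin> X"
      define c where "c i = (if N \<le> Poly_Mapping.lookup m i then 0 else Suc (Poly_Mapping.lookup m i))" for i
      have "X \<subseteq> irr UNIV c"
      proof (rule subsetI, rule ccontr)
        fix u assume u: "u \<in> X" "u \<notin> irr UNIV c"
        obtain g where g: "g \<in> X" "\<And>i. Poly_Mapping.lookup g i \<le> Poly_Mapping.lookup u i"
          "\<And>i. Poly_Mapping.lookup g i \<le> N" using N[OF u(1)] by blast
        have "Poly_Mapping.lookup g i \<le> Poly_Mapping.lookup m i" for i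
        proof (cases "N \<le> Poly_Mapping.lookup m i")
          case True
          then show ?thesis using g(3)[of i] by simp
        next
          case False
          then have c: "c i = Suc (Poly_Mapping.lookup m i)" by (simp add: c_def)
          have "\<not> (0 < c i \<and> c i \<le> Poly_Mapping.lookup u i)" using u(2) unfolding irr_def by blast
          then show ?thesis using g(2)[of i] c by simp
        qed
        then have "m = g + (m - g)"
          by (intro poly_mapping_eqI) (simp add: lookup_add lookup_minus)
        then show False using \<open>m \<notin> X\<close> g(1) assms unfolding up_closed_def by metis
      qed
      then have "c \<in> D" by (simp add: D_def c_def not_le Suc_le_eq)
      then show False using m by (auto simp: irr_def c_def split: if_splits)
    qed
  qed (auto simp: D_def)
  then have "\<exists>C. (C \<subseteq> D \<and> X = ?cap C) \<and> (\<forall>C'. C' \<subseteq> D \<and> X = ?cap C' \<longrightarrow> card C \<le> card C')"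
    by (intro ex_has_least_nat[where k = D]) simp
  then obtain C where C: "C \<subseteq> D" "X = ?cap C"
    and min: "\<And>C'. C' \<subseteq> D \<Longrightarrow> X = ?cap C' \<Longrightarrow> card C \<le> card C'"
    by (elim exE conjE) simp
  have fin: "finite C" using C(1) \<open>finite D\<close> by (rule finite_subset)
  have "\<exists>m. (\<forall>c\<in>C - {k}. m \<in> irr UNIV c) \<and> m \<notin> irr UNIV k" if k: "k \<in> C" for k
  proof (rule ccontr)
    assume "\<not> ?thesis"
    then have "X = ?cap (C - {k})" using C(2) by blast
    then have "card C \<le> card (C - {k})" using C(1) by (intro min) auto
    then show False using card_Diff1_less[OF fin k] by simp
  qed
  then show thesis using that[OF fin C(2)] by blast
qed

lemma exists_monomial_primary_decomposition:
  fixes C :: "('n::finite \<Rightarrow> nat) set"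
  assumes "finite C"
    and irredundant: "\<And>k. k \<in> C \<Longrightarrow> \<exists>m. (\<forall>c\<in>C - {k}. m \<in> irr UNIV c) \<and> m \<notin> irr UNIV k"
  shows "\<exists>Qs. monomial_primary_decomposition
    (supported {m. \<forall>c\<in>C. m \<in> irr UNIV c} :: ('n, 'k::field) polys set) Qs"
proof -
  obtain cs where cs: "set cs = C" using finite_list[OF assms(1)] by blast
  let ?Qs = "map (\<lambda>c. supported (irr UNIV c) :: ('n, 'k) polys set) cs"
  have "(supported {m. \<forall>c\<in>C. m \<in> irr UNIV c} :: ('n, 'k) polys set) = \<Inter> (set ?Qs)"
    by (auto simp: cs supported_def)
  moreover have "Ass_quot (supported {m. \<forall>c\<in>C. m \<in> irr UNIV c} :: ('n, 'k) polys set) = radical ` set ?Qs"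
    by (simp add: Ass_quot_intersection_irr[OF assms] cs image_image radical_irr)
  ultimately have "monomial_primary_decomposition
    (supported {m. \<forall>c\<in>C. m \<in> irr UNIV c} :: ('n, 'k) polys set) ?Qs"
    unfolding monomial_primary_decomposition_def
    using monomial_ideal_supported[OF up_closed_irr, where 'k='k] primary_ideal_irr[where 'k='k] by auto
  then show ?thesis by blast
qed

section \<open>Size and height\<close>

lemma radical_sum_ideals:
  fixes Qs :: "('n::finite, 'k::field) polys set list"
  assumes rad: "\<And>j. j \<in> J \<Longrightarrow> radical (Qs ! j) = supported (meets (A j))"
  shows "radical (sum_ideals Qs J) = supported (meets (\<Union>j\<in>J. A j))"
proof
  interpret module "(*) :: ('n, 'k) polys \<Rightarrow> ('n, 'k) polys \<Rightarrow> ('n, 'k) polys" by (rule module_times)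
  let ?P = "supported (meets (\<Union>j\<in>J. A j)) :: ('n, 'k) polys set"
  have "Qs ! j \<subseteq> ?P" if "j \<in> J" for j
  proof -
    have "Qs ! j \<subseteq> supported (meets (A j))" using subset_radical rad[OF that] by metis
    also have "\<dots> \<subseteq> ?P" using that by (auto simp: supported_meets_subset_iff)
    finally show ?thesis .
  qed
  then have "sum_ideals Qs J \<subseteq> ?P"
    unfolding sum_ideals_def by (intro span_minimal supported_ideal up_closed_meets) auto
  then show "radical (sum_ideals Qs J) \<subseteq> ?P" by (rule prime_ideal_radical_subset[OF prime_ideal_meets])
  show "?P \<subseteq> radical (sum_ideals Qs J)"
  proof (rule supported_meets_subset_ideal)
    show "is_ideal (radical (sum_ideals Qs J))"
      unfolding sum_ideals_def by (intro radical_ideal subspace_span)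
    fix i assume "i \<in> (\<Union>j\<in>J. A j)"
    then obtain j where j: "j \<in> J" "i \<in> A j" by blast
    then have "variable i \<in> radical (Qs ! j)" by (simp add: rad variable_in_meets_iff)
    moreover have "Qs ! j \<subseteq> sum_ideals Qs J"
      unfolding sum_ideals_def using j(1) span_superset by blast
    ultimately show "variable i \<in> radical (sum_ideals Qs J)" using radical_mono by blast
  qed
qed

text \<open>The primes generated by the first \<open>i\<close> variables of an enumeration of \<open>W\<close> form a strict chain. Replacing
the last of them by \<open>P\<close> itself covers the case \<open>P \<noteq> (W)\<close> without lengthening the chain.\<close>

lemma height_prime_ge:
  fixes P :: "('n::finite, 'k::field) polys set"
  assumes P: "prime_ideal P" "supported (meets W) \<subseteq> P"
  shows "enat (card W) \<le> height_prime P"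
proof -
  obtain xs where xs: "set xs = W" "distinct xs" using finite_distinct_list[of W] by auto
  define C where "C i = (if i < length xs then supported (meets (set (take i xs))) else P)" for i
  have "prime_ideal (C i)" for i using P(1) by (simp add: C_def prime_ideal_meets)
  moreover have "C i \<subset> C (Suc i)" if "i < length xs" for i
  proof -
    have take: "take (Suc i) xs = take i xs @ [xs ! i]" using that by (rule take_Suc_conv_app_nth)
    have notin: "xs ! i \<notin> set (take i xs)"
      using distinct_take[OF xs(2), of "Suc i"] unfolding take by simp
    have Ci: "C i = supported (meets (set (take i xs)))" using that by (simp add: C_def)
    have big: "supported (meets (set (take (Suc i) xs))) \<subseteq> C (Suc i)"
    proof (cases "Suc i < length xs")
      case False
      then have "C (Suc i) = P" by (simp add: C_def)
      moreover have "(supported (meets (set (take (Suc i) xs))) :: ('n, 'k) polys set) \<subseteq> supported (meets W)"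
        unfolding supported_meets_subset_iff using xs(1) set_take_subset by metis
      ultimately show ?thesis using P(2) by blast
    qed (simp add: C_def)
    have "C i \<subseteq> supported (meets (set (take (Suc i) xs)))"
      unfolding Ci supported_meets_subset_iff by (auto simp: take)
    moreover have "(variable (xs ! i) :: ('n, 'k) polys) \<in> supported (meets (set (take (Suc i) xs)))"
      unfolding variable_in_meets_iff by (simp add: take)
    moreover have "(variable (xs ! i) :: ('n, 'k) polys) \<notin> C i"
      unfolding Ci variable_in_meets_iff by (rule notin)
    ultimately show ?thesis using big by blast
  qed
  moreover have "C (length xs) = P" by (simp add: C_def)
  moreover have "card W = length xs" using xs distinct_card by metis
  ultimately show ?thesis unfolding height_prime_def by (intro Sup_upper) blast
qed

lemma height_ge:
  fixes J :: "('n::finite, 'k::field) polys set"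
  assumes "radical J = supported (meets W)"
  shows "enat (card W) \<le> height J"
  unfolding height_def
proof (rule Inf_greatest, elim CollectE exE conjE)
  fix h and P :: "('n, 'k) polys set" assume P: "h = height_prime P" "prime_ideal P" "J \<subseteq> P"
  have "supported (meets W) \<subseteq> P"
    using prime_ideal_radical_subset[OF P(2,3)] assms by simp
  then show "enat (card W) \<le> h" unfolding P(1) by (rule height_prime_ge[OF P(2)])
qed

text \<open>A selection \<open>\<sigma>\<close> together with one prime for each variable of \<open>W\<close> that it misses covers
\<open>W\<close>, which bounds \<open>v\<close>. The list \<open>Qs\<close> is arbitrary: only the set of its radicals enters, and \<open>\<iota>\<close>
chooses a position for each member of \<open>C\<close>.\<close>

lemma size_cover_bound:
  fixes Qs :: "('n::finite, 'k::field) polys set list" and C :: "('n \<Rightarrow> nat) set"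
  assumes "finite C"
    and rad: "radical ` set Qs = (\<lambda>c. supported (meets (support c))) ` C"
    and W: "W = (\<Union>c\<in>C. support c)" "W \<noteq> {}"
  shows "0 < size_v Qs" "cover_bound UNIV C (size_v Qs + (CARD('n) - card W))"
    "radical (sum_ideals Qs {..<length Qs}) = supported (meets W)"
proof -
  let ?P = "\<lambda>A. supported (meets A) :: ('n, 'k) polys set"
  have "\<exists>c\<in>C. radical (Qs ! j) = ?P (support c)" if "j < length Qs" for j
  proof -
    have "radical (Qs ! j) \<in> radical ` set Qs" using that by simp
    then show ?thesis unfolding rad by blast
  qed
  then obtain \<gamma> where \<gamma>: "\<And>j. j < length Qs \<Longrightarrow> \<gamma> j \<in> C"
    "\<And>j. j < length Qs \<Longrightarrow> radical (Qs ! j) = ?P (support (\<gamma> j))" by metis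
  have "\<exists>j<length Qs. support (\<gamma> j) = support c" if "c \<in> C" for c
  proof -
    have "?P (support c) \<in> radical ` set Qs" unfolding rad using that by blast
    then obtain j where "j < length Qs" "radical (Qs ! j) = ?P (support c)"
      by (auto simp: in_set_conv_nth)
    then show ?thesis using \<gamma>(2) supported_meets_eq_iff by metis
  qed
  then obtain \<iota> where \<iota>: "\<And>c. c \<in> C \<Longrightarrow> \<iota> c < length Qs" "\<And>c. c \<in> C \<Longrightarrow> support (\<gamma> (\<iota> c)) = support c"
    by metis
  have radJ: "radical (sum_ideals Qs J) = ?P (\<Union>j\<in>J. support (\<gamma> j))" if "J \<subseteq> {..<length Qs}" for J
    using that \<gamma>(2) by (intro radical_sum_ideals) auto
  have "(\<Union>j<length Qs. support (\<gamma> j)) = W"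
    unfolding W(1) using \<gamma>(1) \<iota> by fast
  then show total: "radical (sum_ideals Qs {..<length Qs}) = ?P W" using radJ[of "{..<length Qs}"] by simp
  let ?ok = "\<lambda>t. \<exists>J. J \<noteq> {} \<and> J \<subseteq> {..<length Qs} \<and> card J = t \<and>
    radical (sum_ideals Qs J) = radical (sum_ideals Qs {..<length Qs})"
  have cover: "?ok (card J)" if "J \<subseteq> {..<length Qs}" "(\<Union>j\<in>J. support (\<gamma> j)) = W" for J
    using that W(2) radJ[OF that(1)] total by (intro exI[of _ J]) auto
  have "?ok (size_v Qs)"
    unfolding size_v_def
    by (rule LeastI, rule cover[of "{..<length Qs}"]) (use \<open>(\<Union>j<length Qs. support (\<gamma> j)) = W\<close> in auto)
  then obtain J where "J \<noteq> {}" "J \<subseteq> {..<length Qs}" "card J = size_v Qs" by blast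
  then show "0 < size_v Qs" using finite_subset[of J "{..<length Qs}"] by (metis card_gt_0_iff finite_lessThan)
  show "cover_bound UNIV C (size_v Qs + (CARD('n) - card W))"
    unfolding cover_bound_def
  proof (intro allI impI)
    fix \<sigma> assume \<sigma>: "\<sigma> \<subseteq> C"
    let ?U = "\<Union>c\<in>\<sigma>. support c"
    have "\<forall>i\<in>W. \<exists>c\<in>C. i \<in> support c" unfolding W(1) by blast
    then obtain \<kappa> where \<kappa>: "\<And>i. i \<in> W \<Longrightarrow> \<kappa> i \<in> C" "\<And>i. i \<in> W \<Longrightarrow> i \<in> support (\<kappa> i)" by metis
    define K where "K = \<sigma> \<union> \<kappa> ` (W - ?U)"
    have K: "K \<subseteq> C" using \<sigma> \<kappa>(1) by (auto simp: K_def)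
    have "(\<Union>c\<in>K. support c) = W"
    proof
      show "(\<Union>c\<in>K. support c) \<subseteq> W" unfolding W(1) using K by blast
      show "W \<subseteq> (\<Union>c\<in>K. support c)" unfolding K_def using \<kappa>(2) by blast
    qed
    moreover have "(\<Union>j\<in>\<iota> ` K. support (\<gamma> j)) = (\<Union>c\<in>K. support c)"
      unfolding image_image using K \<iota>(2) by auto
    ultimately have "?ok (card (\<iota> ` K))" using K \<iota>(1) by (intro cover) auto
    then have "size_v Qs \<le> card (\<iota> ` K)" unfolding size_v_def by (rule Least_le)
    also have "\<dots> \<le> card K" using K assms(1) by (intro card_image_le) (rule finite_subset)
    also have "\<dots> \<le> card \<sigma> + card (\<kappa> ` (W - ?U))" unfolding K_def by (rule card_Un_le)
    also have "\<dots> \<le> card \<sigma> + card (W - ?U)" by (simp add: card_image_le)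
    finally have v: "size_v Qs \<le> card \<sigma> + card (W - ?U)" .
    have "?U \<subseteq> W" unfolding W(1) using \<sigma> by blast
    then have "card (UNIV - ?U) = card (W - ?U) + card (UNIV - W)"
      by (subst card_Un_disjoint[symmetric]) (auto intro: arg_cong[of _ _ card])
    moreover have "card (UNIV - W) = CARD('n) - card W" by (simp add: card_Diff_subset)
    ultimately show "size_v Qs + (CARD('n) - card W) \<le> card \<sigma> + card (UNIV - ?U)" using v by simp
  qed
qed

section \<open>The Stanley depth is at least the size plus one\<close>

theorem theorem3p1:
  fixes I :: "('n::finite, 'k::field) polys set"
  assumes "monomial_ideal I" and "I \<noteq> {0}" and "I \<noteq> UNIV"
  shows "enat (sdepth_ideal I) \<ge> 1 + ideal_size I"
proof -
  obtain A where "I = ideal_gen (monomial ` A)" using assms(1) unfolding monomial_ideal_def by blast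
  then have I0: "I = supported {a + w | a w. a \<in> A}" by (simp add: ideal_gen_monomials)
  have "up_closed {a + w | a w. a \<in> A}"
    unfolding up_closed_def by (clarsimp, metis add.assoc)
  then obtain C where C: "finite C" "{a + w | a w. a \<in> A} = {m. \<forall>c\<in>C. m \<in> irr UNIV c}"
    and irredundant: "\<And>k. k \<in> C \<Longrightarrow> \<exists>m. (\<forall>c\<in>C - {k}. m \<in> irr UNIV c) \<and> m \<notin> irr UNIV k"
    by (rule irreducible_decomposition) blast
  let ?X = "{m. \<forall>c\<in>C. m \<in> irr UNIV c}"
  have I: "I = supported ?X" using I0 C(2) by simp
  \<comment> \<open>The size refers to an unspecified decomposition \<open>Qs\<close>; it is compared with \<open>C\<close> through \<open>Ass_quot I\<close>.\<close>
  define Qs where "Qs = (SOME Qs. monomial_primary_decomposition I Qs)"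
  have "monomial_primary_decomposition I Qs"
    unfolding Qs_def I by (rule someI_ex[OF exists_monomial_primary_decomposition[OF C(1) irredundant]])
  then have rad: "radical ` set Qs = (\<lambda>c. supported (meets (support c))) ` C"
    using Ass_quot_intersection_irr[OF C(1) irredundant, where 'k='k]
    unfolding monomial_primary_decomposition_def I by simp
  define W where "W = (\<Union>c\<in>C. support c)"
  have "C \<noteq> {}" using assms(3) by (auto simp: I supported_def)
  moreover have "support c \<noteq> {}" if "c \<in> C" for c
  proof
    assume "support c = {}"
    then have "irr UNIV c = {}" by (auto simp: irr_def support_def)
    then have "?X = {}" using that by auto
    then have "I = supported {}" using I by metis
    then show False using assms(2) by (simp add: supported_empty)
  qed
  ultimately have "W \<noteq> {}" unfolding W_def by blast
  note size = size_cover_bound[OF C(1) rad W_def \<open>W \<noteq> {}\<close>]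
  let ?d = "size_v Qs + (CARD('n) - card W)"
  have "box_partition ?d ?X"
    using box_partition_intersection[OF C(1) size(2)] by (simp add: monoms_on_def)
  then have d: "?d \<le> sdepth_ideal I"
    unfolding I by (rule sdepth_ideal_ge_of_box_partition) (use assms(2) I in simp)
  have "enat (card W) \<le> height (sum_ideals Qs {..<length Qs})"
    by (rule height_ge[OF size(3)])
  then have "enat CARD('n) - height (sum_ideals Qs {..<length Qs}) \<le> enat (CARD('n) - card W)"
    by (cases "height (sum_ideals Qs {..<length Qs})") auto
  then have "1 + ideal_size I \<le> enat ?d"
    using size(1)
    unfolding ideal_size_def decomposition_size_def Qs_def[symmetric]
    by (cases "enat CARD('n) - height (sum_ideals Qs {..<length Qs})") (auto simp: one_enat_def)
  also have "\<dots> \<le> enat (sdepth_ideal I)" using d by simp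
  finally show ?thesis .
qed

end
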